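(* Let $\varepsilon>0$. Under Assumptions (1)–(5) listed in the context, let $\{x^k,y^k,z^k\}$ be generated by the damped proximal augmented Lagrangian method (DPALM) described in the context with $$\beta_k=\beta_0\sqrt{k+1},\qquad v_k=\frac{v_0}{\sqrt{k+1}\,(\log(k+1))^2}\quad(k\ge1)$$ for some $\beta_0>0$, $v_0>0$ (which are also the values at $k=0$), such that for all $k\ge0$ $$\widetilde{\mathcal L}_{\beta_k}(x^{k+1};y^k,z^k)-\min_x\widetilde{\mathcal L}_{\beta_k}(x;y^k,z^k)\le\frac{\varepsilon_k^2}{\rho},$$ where $$\varepsilon_k:=\min\Big\{\frac\varepsilon4,\frac{\rho\varepsilon}{\sqrt2},1,\sqrt{\frac{\rho}{2\beta_k}},\frac1{\beta_k(k+2)(\log(k+2))^2}\Big\}.$$ Then for some $k<K:=\widetilde K_1+\widetilde K_2$, $x^{k+1}$ is a near $\varepsilon$-KKT point of problem (P), where $$\widetilde K_1:=\Big\lceil\max\big\{C_p^2\beta_0^{-2},\ (B_p^2+\tfrac{5C_p^2}4)^2\beta_0^{-2}\big\}\varepsilon^{-2}\Big\rceil,\qquad\widetilde K_2:=\lceil16C_x\rho\,\varepsilon^{-2}\rceil,$$ with $B_p,C_p,C_x$ defined in the context.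
   Context: Problem (P): $\min_{x\in\mathbb R^d}F(x):=f(x)+h(x)$ subject to $Ax=b$, $g(x):=[g_1(x),\dots,g_m(x)]\le 0$, where $A\in\mathbb R^{n\times d}$, $b\in\mathbb R^n$, and $F$ is continuous on its domain $\mathcal X:=\mathrm{dom}(F)$. $\|\cdot\|$ is the Euclidean (spectral, for matrices) norm; $[a]_+$ is the componentwise positive part; $\log$ is natural. For a $\rho$-weakly convex $\psi$ (i.e. $\psi+\frac\rho2\|\cdot\|^2$ convex), $\partial\psi(x):=\partial(\psi+\frac\rho2\|\cdot\|^2)(x)-\rho x$, the right-hand subdifferential being the usual convex one. Assumptions. (1) $\mathcal X$ is compact with diameter $D=\max_{x_1,x_2\in\mathcal X}\|x_1-x_2\|$; $f$ is $\rho$-weakly convex on $\mathcal X$ for some $\rho>0$; $h$ is closed convex and admits an efficient proximal mapping. (2) Each $g_i:\mathbb R^d\to\mathbb R$ is convex and $L_g$-smooth (gradient $L_g$-Lipschitz) on an open set containing $\mathcal X$. (3) There is $x_{\rm feas}\in\mathrm{int}(\mathcal X)$ with $Ax_{\rm feas}=b$ and $g_{\min}:=\min_{i}-g_i(x_{\rm feas})>0$. (4) There is $r_h>0$ with $\emptyset\ne\partial h(x)\subseteq\mathcal N_{\mathcal X}(x)+\{u:\|u\|\le r_h\}$ for all $x\in\mathcal X$ ($\mathcal N_{\mathcal X}$ is the normal cone). (5) There is $\widehat B_f$ with $\|\xi\|\le\widehat B_f$ for any $\xi\in\partial f(x)$ and any $x\in\mathcal X$. $B_g>0$ is a constant with $\max\{|g_i(x)|,\|\nabla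 g_i(x)\|\}\le B_g$ and $|g_i(x)-g_i(\tilde x)|\le B_g\|x-\tilde x\|$ for all $x,\tilde x\in\mathcal X$, $i\in[m]$. Augmented Lagrangian: $\mathcal L_\beta(x;y,z)=F(x)+y^\top(Ax-b)+\frac\beta2\|Ax-b\|^2+\frac\beta2\|[g(x)+\frac z\beta]_+\|^2-\frac{\|z\|^2}{2\beta}$. DPALM: choose $x^0\in\mathcal X$, $y^0\in\mathrm{Range}(A)$, $z^0\ge0$. For $k=0,1,\dots$: let $x^{k+1}$ be an approximate minimizer of $\widetilde{\mathcal L}_{\beta_k}(x;y^k,z^k):=\mathcal L_{\beta_k}(x;y^k,z^k)+\rho\|x-x^k\|^2$; set $y^{k+1}=y^k+\alpha_k(Ax^{k+1}-b)$, $z^{k+1}=z^k+\alpha_k\max\{-z^k/\beta_k,\,g(x^{k+1})\}$ (componentwise max), with $\alpha_k=\min\big\{\beta_k,\ v_k/\sqrt{\|Ax^{k+1}-b\|^2+\|[g(x^{k+1})]_+\|^2}\big\}$ and the convention $v/0=+\infty$ for $v>0$. $\varepsilon$-KKT point: $x\in\mathcal X$ for which there exist $y\in\mathbb R^n$, $z\in\mathbb R^m_+$ with $\max\{\operatorname{dist}(0,\partial F(x)+J_g(x)^\top z+A^\top y),\ \sqrt{\|Ax-b\|^2+\|[g(x)]_+\|^2},\ \sum_{i=1}^m|z_ig_i(x)|\}\le\varepsilon$ ($J_g$ Jacobian of $g$). Near $\varepsilon$-KKT point: a point $\bar x$ with $\|\bar x-x\|\le\varepsilon$ for some $\varepsilon$-KKT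 point $x$. Constants ($\lambda_{\min}^+$ = smallest positive eigenvalue, $\mathrm{bd}$ = boundary, $\dagger$ = pseudoinverse), with $\delta_k:=\sqrt2\,\varepsilon_k/\rho$: $\tau=\min\{\frac{g_{\min}}{2\sqrt mB_g},\operatorname{dist}(x_{\rm feas},\mathrm{bd}(\mathcal X))\}$; $\overline B=D(r_h+\widehat B_f)+2\rho D^2+D+\tau(1+r_h+\widehat B_f+2\rho D)$; $\theta=\overline B/\min\{\tau\sqrt{\lambda_{\min}^+(AA^\top)},\frac{g_{\min}}2\}$; $B_p=\max\{\|(y^0,z^0)\|,\theta\}+\sum_{j\ge0}\alpha_j\delta_j(\|A\|+\sqrt mB_g)$; $Q=D(\widehat B_f+2\rho D+r_h)$; $C_1=\frac1D+\frac1{\operatorname{dist}(x_{\rm feas},\mathrm{bd}(\mathcal X))}+\frac{B_g}{g_{\min}}$; $\widehat C_p=2\Big(B_p+\sqrt{\frac{Q^2}{g_{\min}^2}+Q^2\|(AA^\top)^\dagger A\|^2C_1^2}\Big)+1$; $C_p=2\widehat C_p+\sum_{j\ge0}\beta_j\delta_j(\|A\|+\sqrt mB_g)$; $C_x=2\max_{x\in\mathcal X}|F(x)|+\frac1{4\beta_0}(14C_p^2+8B_pC_p+7B_p^2)+(10C_p+4B_p)\frac{v_0}{\beta_0}+\frac{\beta_0}2\big(\|Ax^0-b\|^2+\|[g(x^0)+\frac{z^0}{\beta_0}]_+\|^2\big)+|\langle y^0,Ax^0-b\rangle|$. *)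

theory Defs
  imports "HOL-Analysis.Analysis"
begin

section \<open>Extended-real-valued functions\<close>

definition effective_dom :: "('a \<Rightarrow> ereal) \<Rightarrow> 'a set" where
  "effective_dom \<phi> = {x. \<phi> x < \<infinity>}"

definition ereal_epigraph_on :: "'a set \<Rightarrow> ('a \<Rightarrow> ereal) \<Rightarrow> ('a \<times> real) set" where
  "ereal_epigraph_on S \<phi> = {(x, t). x \<in> S \<and> \<phi> x \<le> ereal t}"

definition ereal_convex_on :: "'a::real_vector set \<Rightarrow> ('a \<Rightarrow> ereal) \<Rightarrow> bool" where
  "ereal_convex_on S \<phi> \<longleftrightarrow> convex S \<and> convex (ereal_epigraph_on S \<phi>)"

text \<open>Closedness in the sense of convex analysis: the epigraph is a closed set.\<close>

definition closed_fun :: "('a::topological_space \<Rightarrow> ereal) \<Rightarrow> bool" where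
  "closed_fun \<phi> \<longleftrightarrow> closed (ereal_epigraph_on UNIV \<phi>)"

definition add_quadratic :: "real \<Rightarrow> ('a::real_inner \<Rightarrow> ereal) \<Rightarrow> 'a \<Rightarrow> ereal" where
  "add_quadratic \<rho> \<psi> x = \<psi> x + ereal (\<rho> / 2 * (norm x)\<^sup>2)"

definition weakly_convex_on :: "real \<Rightarrow> 'a::real_inner set \<Rightarrow> ('a \<Rightarrow> ereal) \<Rightarrow> bool" where
  "weakly_convex_on \<rho> S \<psi> \<longleftrightarrow> ereal_convex_on S (add_quadratic \<rho> \<psi>)"

text \<open>Subgradients at \<open>x\<close>, with the subgradient inequality tested on \<open>S\<close>. For \<open>S = UNIV\<close>
  this is the usual convex subdifferential.\<close>

definition subdifferential_on :: "'a::real_inner set \<Rightarrow> ('a \<Rightarrow> ereal) \<Rightarrow> 'a \<Rightarrow> 'a set" where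
  "subdifferential_on S \<phi> x =
     {\<xi>. \<bar>\<phi> x\<bar> \<noteq> \<infinity> \<and> (\<forall>y\<in>S. \<phi> x + ereal (\<xi> \<bullet> (y - x)) \<le> \<phi> y)}"

abbreviation subdifferential :: "('a::real_inner \<Rightarrow> ereal) \<Rightarrow> 'a \<Rightarrow> 'a set" where
  "subdifferential \<equiv> subdifferential_on UNIV"

definition weak_subdifferential :: "real \<Rightarrow> ('a::real_inner \<Rightarrow> ereal) \<Rightarrow> 'a \<Rightarrow> 'a set" where
  "weak_subdifferential \<rho> \<psi> x =
     (\<lambda>\<xi>. \<xi> - \<rho> *\<^sub>R x) ` subdifferential (add_quadratic \<rho> \<psi>) x"

text \<open>
  A function that is only required to be weakly convex on a set may fail the subgradient inequality
  far away from that set. Its subdifferential is therefore formed from the subgradient inequality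
  in an arbitrary neighbourhood of the point. By the lemma below this is the global
  notion as soon as the function is weakly convex on the whole space.
\<close>

definition local_weak_subdifferential ::
  "real \<Rightarrow> ('a::real_inner \<Rightarrow> ereal) \<Rightarrow> 'a \<Rightarrow> 'a set" where
  "local_weak_subdifferential \<rho> \<psi> x =
     (\<lambda>\<xi>. \<xi> - \<rho> *\<^sub>R x) ` (\<Union>U\<in>{U. open U \<and> x \<in> U}. subdifferential_on U (add_quadratic \<rho> \<psi>) x)"

lemma local_subgradient_imp_global:
  fixes \<phi> :: "'a::real_inner \<Rightarrow> ereal"
  assumes conv: "ereal_convex_on S \<phi>" and U: "open U" "x \<in> U" and "x \<in> S"
    and \<xi>: "\<xi> \<in> subdifferential_on U \<phi> x"
  shows "\<xi> \<in> subdifferential_on S \<phi> x"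
proof -
  from \<xi> have fin: "\<bar>\<phi> x\<bar> \<noteq> \<infinity>"
    and loc: "\<And>y. y \<in> U \<Longrightarrow> \<phi> x + ereal (\<xi> \<bullet> (y - x)) \<le> \<phi> y"
    by (auto simp: subdifferential_on_def)
  then obtain p where p: "\<phi> x = ereal p" by (cases "\<phi> x") auto
  have key: "p + \<xi> \<bullet> (y - x) \<le> t" if "y \<in> S" "\<phi> y \<le> ereal t" for y t
  proof -
    have "((\<lambda>s. x + s *\<^sub>R (y - x)) \<longlongrightarrow> x + 0 *\<^sub>R (y - x)) (at_right 0)"
      by (intro tendsto_intros)
    then have "\<forall>\<^sub>F s in at_right 0. x + s *\<^sub>R (y - x) \<in> U"
      using U topological_tendstoD by fastforce
    moreover have "\<forall>\<^sub>F s in at_right (0::real). s \<in> {0<..<1}"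
      by (rule eventually_at_right_real) simp
    ultimately have "\<forall>\<^sub>F s in at_right (0::real). x + s *\<^sub>R (y - x) \<in> U \<and> s \<in> {0<..<1}"
      by (rule eventually_conj)
    then obtain s :: real where s: "x + s *\<^sub>R (y - x) \<in> U" "0 < s" "s < 1"
      using eventually_happens[of _ "at_right (0::real)"] by auto
    have "(1 - s) *\<^sub>R (x, p) + s *\<^sub>R (y, t) \<in> ereal_epigraph_on S \<phi>"
      by (rule convexD) (use conv that s p \<open>x \<in> S\<close> in
          \<open>auto simp: ereal_convex_on_def ereal_epigraph_on_def\<close>)
    moreover have "(1 - s) *\<^sub>R x + s *\<^sub>R y = x + s *\<^sub>R (y - x)"
      by (simp add: algebra_simps)
    ultimately have "\<phi> (x + s *\<^sub>R (y - x)) \<le> ereal ((1 - s) * p + s * t)"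
      by (simp add: ereal_epigraph_on_def)
    then have "ereal p + ereal (\<xi> \<bullet> (s *\<^sub>R (y - x))) \<le> ereal ((1 - s) * p + s * t)"
      using loc[OF s(1)] p by (metis add_diff_cancel_left' order.trans)
    then have "p + s * (\<xi> \<bullet> (y - x)) \<le> (1 - s) * p + s * t"
      by simp
    then have "s * (p + \<xi> \<bullet> (y - x)) \<le> s * t"
      by (simp add: algebra_simps)
    then show ?thesis using s by simp
  qed
  have "ereal (p + \<xi> \<bullet> (y - x)) \<le> \<phi> y" if "y \<in> S" for y
  proof (cases "\<phi> y")
    case (real t)
    then show ?thesis using key[OF that, of t] by simp
  next
    case MInf
    then show ?thesis using key[OF that, of "p + \<xi> \<bullet> (y - x) - 1"] by simp
  qed simp
  then show ?thesis using fin p by (simp add: subdifferential_on_def)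
qed

lemma local_weak_subdifferential_eq:
  assumes "weakly_convex_on \<rho> UNIV \<psi>"
  shows "local_weak_subdifferential \<rho> \<psi> x = weak_subdifferential \<rho> \<psi> x"
proof -
  have conv: "ereal_convex_on UNIV (add_quadratic \<rho> \<psi>)"
    using assms by (simp add: weakly_convex_on_def)
  have "(\<Union>U\<in>{U. open U \<and> x \<in> U}. subdifferential_on U (add_quadratic \<rho> \<psi>) x)
      = subdifferential (add_quadratic \<rho> \<psi>) x" (is "?L = ?R")
  proof
    show "?L \<subseteq> ?R"
      using local_subgradient_imp_global[OF conv _ _ UNIV_I] by blast
    show "?R \<subseteq> ?L"
      by (rule UN_upper) simp
  qed
  then show ?thesis
    by (simp add: local_weak_subdifferential_def weak_subdifferential_def)
qed

definition normal_cone :: "'a::real_inner set \<Rightarrow> 'a \<Rightarrow> 'a set" where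
  "normal_cone S x = {u. \<forall>y\<in>S. u \<bullet> (y - x) \<le> 0}"


section \<open>Vectors and matrices\<close>

definition pos_part :: "real^'m \<Rightarrow> real^'m" where
  "pos_part a = (\<chi> i. max (a $ i) 0)"

definition grad :: "('a::real_inner \<Rightarrow> real) \<Rightarrow> 'a \<Rightarrow> 'a" where
  "grad \<phi> x = (THE G. GDERIV \<phi> x :> G)"

definition spectral_norm :: "real^'d^'n \<Rightarrow> real" where
  "spectral_norm M = onorm ((*v) M)"

definition eigenvalues :: "real^'n^'n \<Rightarrow> real set" where
  "eigenvalues M = {l. \<exists>v. v \<noteq> 0 \<and> M *v v = l *\<^sub>R v}"

definition lambda_min_pos :: "real^'n^'n \<Rightarrow> real" where
  "lambda_min_pos M = Min {l \<in> eigenvalues M. l > 0}"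

text \<open>The Moore--Penrose inverse, characterised by the four Penrose equations.\<close>

definition pseudoinverse :: "real^'d^'n \<Rightarrow> real^'n^'d" where
  "pseudoinverse M = (THE P. M ** P ** M = M \<and> P ** M ** P = P \<and>
     transpose (M ** P) = M ** P \<and> transpose (P ** M) = P ** M)"


section \<open>The constrained problem and the augmented Lagrangian\<close>

definition constraint_violation ::
  "real^'d^'n \<Rightarrow> real^'n \<Rightarrow> (real^'d \<Rightarrow> real^'m) \<Rightarrow> real^'d \<Rightarrow> real" where
  "constraint_violation A b g x =
     sqrt ((norm (A *v x - b))\<^sup>2 + (norm (pos_part (g x)))\<^sup>2)"

definition aug_lagrangian ::
  "(real^'d \<Rightarrow> ereal) \<Rightarrow> real^'d^'n \<Rightarrow> real^'n \<Rightarrow> (real^'d \<Rightarrow> real^'m) \<Rightarrow>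
   real \<Rightarrow> real^'d \<Rightarrow> real^'n \<Rightarrow> real^'m \<Rightarrow> ereal" where
  "aug_lagrangian F A b g \<beta> x y z =
     F x + ereal (y \<bullet> (A *v x - b) + \<beta> / 2 * (norm (A *v x - b))\<^sup>2
       + \<beta> / 2 * (norm (pos_part (g x + z /\<^sub>R \<beta>)))\<^sup>2 - (norm z)\<^sup>2 / (2 * \<beta>))"

definition prox_aug_lagrangian ::
  "(real^'d \<Rightarrow> ereal) \<Rightarrow> real^'d^'n \<Rightarrow> real^'n \<Rightarrow> (real^'d \<Rightarrow> real^'m) \<Rightarrow>
   real \<Rightarrow> real \<Rightarrow> real^'d \<Rightarrow> real^'d \<Rightarrow> real^'n \<Rightarrow> real^'m \<Rightarrow> ereal" where
  "prox_aug_lagrangian F A b g \<rho> \<beta> xc x y z =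
     aug_lagrangian F A b g \<beta> x y z + ereal (\<rho> * (norm (x - xc))\<^sup>2)"

text \<open>The case distinction implements the convention \<open>v / 0 = \<infinity>\<close>.\<close>

definition damped_step :: "real \<Rightarrow> real \<Rightarrow> real \<Rightarrow> real" where
  "damped_step \<beta> v r = (if r = 0 then \<beta> else min \<beta> (v / r))"

definition stationarity_set ::
  "real \<Rightarrow> (real^'d \<Rightarrow> ereal) \<Rightarrow> real^'d^'n \<Rightarrow> (real^'d \<Rightarrow> real^'m) \<Rightarrow>
   real^'d \<Rightarrow> real^'n \<Rightarrow> real^'m \<Rightarrow> (real^'d) set" where
  "stationarity_set \<rho> F A g x y z =
     {\<xi> + transpose (jacobian g (at x)) *v z + transpose A *v y | \<xi>.
        \<xi> \<in> weak_subdifferential \<rho> F x}"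

text \<open>Nonemptiness is required separately because \<^const>\<open>infdist\<close> assigns distance
  \<open>0\<close>, not \<open>\<infinity>\<close>, to the empty set.\<close>

definition eps_kkt_point ::
  "real \<Rightarrow> (real^'d \<Rightarrow> ereal) \<Rightarrow> real^'d^'n \<Rightarrow> real^'n \<Rightarrow> (real^'d \<Rightarrow> real^'m) \<Rightarrow>
   real \<Rightarrow> real^'d \<Rightarrow> bool" where
  "eps_kkt_point \<rho> F A b g \<epsilon> x \<longleftrightarrow>
     x \<in> effective_dom F \<and>
     (\<exists>y z. (\<forall>i. 0 \<le> z $ i) \<and>
        stationarity_set \<rho> F A g x y z \<noteq> {} \<and>
        Max {infdist 0 (stationarity_set \<rho> F A g x y z),
             constraint_violation A b g x,
             (\<Sum>i\<in>UNIV. \<bar>z $ i * g x $ i\<bar>)} \<le> \<epsilon>)"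

definition near_eps_kkt_point ::
  "real \<Rightarrow> (real^'d \<Rightarrow> ereal) \<Rightarrow> real^'d^'n \<Rightarrow> real^'n \<Rightarrow> (real^'d \<Rightarrow> real^'m) \<Rightarrow>
   real \<Rightarrow> real^'d \<Rightarrow> bool" where
  "near_eps_kkt_point \<rho> F A b g \<epsilon> xbar \<longleftrightarrow>
     (\<exists>x. eps_kkt_point \<rho> F A b g \<epsilon> x \<and> norm (xbar - x) \<le> \<epsilon>)"

text \<open>Denominator of \<open>\<theta>\<close>. For \<open>A = 0\<close> there is no positive eigenvalue; the minimum over the
  empty set counts as \<open>\<infinity>\<close>, so that the first term drops out.\<close>

definition theta_denom :: "real^'d^'n \<Rightarrow> real \<Rightarrow> real \<Rightarrow> real" where
  "theta_denom A \<tau> gmin =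
     (if A = 0 then gmin / 2
      else min (\<tau> * sqrt (lambda_min_pos (A ** transpose A))) (gmin / 2))"

end

theory Submission
  imports Defs
begin

text \<open>
  Let \<open>u k\<close> be the exact minimiser of the \<open>k\<close>-th proximal subproblem. By strong convexity it is
  within \<open>\<delta> k\<close> of \<open>x (Suc k)\<close>, and the multiplier update at \<open>u k\<close> makes it stationary up to
  \<open>2 * \<rho> * norm (u k - x k)\<close>. If that update increased the norm of the multiplier, the Slater point
  would force the updated multiplier below \<open>\<theta>\<close>; hence all multipliers stay bounded by \<open>Bp\<close>
  (a damped step is a convex combination of the old and the fully updated multiplier), and
  infeasibility and complementarity decay like \<open>1 / \<beta> k\<close>. From \<open>K1\<close> on only stationarity can fail,
  and each failure decreases the augmented Lagrangian by more than \<open>\<epsilon>\<^sup>2 / (16 * \<rho>)\<close>. The changes of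
  the augmented Lagrangian caused by updating multipliers and penalty telescope or are dominated by
  \<open>1 / \<beta> k - 1 / \<beta> (Suc k)\<close> and \<open>v k / \<beta> k\<close>, so the total decrease is at most \<open>Cx\<close>.
\<close>

section \<open>Convex analysis and matrix preliminaries\<close>

text \<open>The obstacle is the boundary of the domain: there \<open>h\<close> may have arbitrarily
  steep subgradients in normal directions, so no Lipschitz bound for \<open>F\<close> is at hand at
  the minimisers \<open>u k\<close>. Subgradients of \<open>f\<close> and \<open>h\<close> are
  therefore bounded at interior points only, where the normal cone is trivial. They limit how far
  \<open>F\<close> can rise from any point of \<open>X\<close> to an interior one, and a test at a
  shifted Slater point asks for exactly this one-sided bound. Stationarity, in contrast, is read off
  the variational inequality of the subproblem, with \<open>F\<close> treated as a whole. The
  proximal term has convexity modulus \<open>2 * \<rho>\<close>, of which weak convexity consumes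
  \<rho>; the remaining \<rho> is the source of
  \<open>\<delta> k = sqrt 2 * \<epsilon>s k / \<rho>\<close>. The errors can be summed because
  infeasibility is of order \<open>1 / \<beta> k\<close>: it enters the cost of a larger penalty
  squared, which leaves a telescoping difference, while damping caps \<open>\<alpha> k\<close> times
  infeasibility by \<open>v k\<close>, which leaves a convergent logarithmic series.\<close>

text \<open>A hyperplane separating \<open>(p, \<phi> p)\<close> from the strict epigraph over
  \<open>S\<close> cannot be vertical, because \<open>S\<close> contains a ball around
  \<open>p\<close>; its normalised slope is the subgradient.\<close>

lemma convex_on_subgradient_exists:
  fixes \<phi> :: "'a::euclidean_space \<Rightarrow> real"
  assumes "open S" and conv: "convex_on S \<phi>" and p: "p \<in> S"
  obtains \<xi> where "\<And>q. q \<in> S \<Longrightarrow> \<phi> p + \<xi> \<bullet> (q - p) \<le> \<phi> q"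
proof -
  define E where "E = {(q, t). q \<in> S \<and> \<phi> q < t}"
  have "convex E"
  proof (rule convexI, clarsimp simp: E_def)
    fix q t q' t' and u v :: real
    assume h: "q \<in> S" "\<phi> q < t" "q' \<in> S" "\<phi> q' < t'" "0 \<le> u" "0 \<le> v" "u + v = 1"
    have "\<phi> (u *\<^sub>R q + v *\<^sub>R q') \<le> u * \<phi> q + v * \<phi> q'"
      using conv h by (auto simp: convex_on_def)
    also have "\<dots> < u * t + v * t'"
    proof (cases "u = 0")
      case False
      then have "u * \<phi> q < u * t" "v * \<phi> q' \<le> v * t'"
        using h by (auto intro: mult_left_mono)
      then show ?thesis by linarith
    qed (use h in auto)
    finally show "u *\<^sub>R q + v *\<^sub>R q' \<in> S \<and> \<phi> (u *\<^sub>R q + v *\<^sub>R q') < u * t + v * t'"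
      using conv h by (auto simp: convex_on_def convex_def)
  qed
  moreover have "(p, \<phi> p + 1) \<in> E" using p by (simp add: E_def)
  moreover have "(p, \<phi> p) \<notin> E" by (simp add: E_def)
  ultimately have "\<exists>n c. n \<noteq> 0 \<and> (\<forall>e\<in>{(p, \<phi> p)}. n \<bullet> e \<le> c) \<and> (\<forall>e\<in>E. c \<le> n \<bullet> e)"
    by (intro separating_hyperplane_sets) auto
  then obtain n c where n: "n \<noteq> 0" "n \<bullet> (p, \<phi> p) \<le> c" "\<And>e. e \<in> E \<Longrightarrow> c \<le> n \<bullet> e"
    by blast
  obtain a s where ns: "n = (a, s)" by (cases n)
  have key: "0 \<le> a \<bullet> (q - p) + s * (t - \<phi> p)" if "q \<in> S" "\<phi> q < t" for q t
    using n(2) n(3)[of "(q, t)"] that by (simp add: ns E_def inner_simps algebra_simps)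
  have "0 \<le> s" using key[OF p, of "\<phi> p + 1"] by simp
  moreover have "s \<noteq> 0"
  proof
    assume s: "s = 0"
    obtain e where e: "0 < e" "cball p e \<subseteq> S"
      using \<open>open S\<close> p open_contains_cball by blast
    have "a \<noteq> 0" using n(1) ns s by (auto simp: zero_prod_def)
    let ?q = "p - (e / norm a) *\<^sub>R a"
    have "?q \<in> S" using e \<open>a \<noteq> 0\<close> by (auto intro!: subsetD[OF e(2)] simp: dist_norm)
    then have "0 \<le> - ((e / norm a) * (a \<bullet> a))" using key[of ?q "\<phi> ?q + 1"] s by simp
    moreover have "(e / norm a) * (a \<bullet> a) > 0" using e \<open>a \<noteq> 0\<close> by simp
    ultimately show False by linarith
  qed
  ultimately have s: "s > 0" by simp
  have "\<phi> p + ((-1 / s) *\<^sub>R a) \<bullet> (q - p) \<le> \<phi> q" if "q \<in> S" for q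
  \<comment> \<open>The strict epigraph yields the bound only for every \<open>t\<close> above
    \<open>\<phi> q\<close>.\<close>
  proof (rule dense_ge)
    fix t assume "\<phi> q < t"
    from key[OF that this] s show "\<phi> p + ((-1 / s) *\<^sub>R a) \<bullet> (q - p) \<le> t"
      by (simp add: field_simps)
  qed
  then show ?thesis by (rule that)
qed

section \<open>Spectral lower bound for the transpose of A on the range of A\<close>

text \<open>Eigenvectors for distinct eigenvalues of a symmetric matrix are orthogonal, hence
  independent. Finiteness is what gives the \<open>Min\<close> in \<open>lambda_min_pos\<close> its
  meaning.\<close>

lemma finite_eigenvalues_symmetric:
  fixes M :: "real^'n^'n"
  assumes sym: "transpose M = M"
  shows "finite (eigenvalues M)"
proof -
  define V where "V l = (SOME v. v \<noteq> 0 \<and> M *v v = l *\<^sub>R v)" for l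
  have V: "V l \<noteq> 0" "M *v V l = l *\<^sub>R V l" if "l \<in> eigenvalues M" for l
    using someI_ex[of "\<lambda>v. v \<noteq> 0 \<and> M *v v = l *\<^sub>R v"] that
    by (auto simp: eigenvalues_def V_def)
  have orth: "V l \<bullet> V l' = 0" if "l \<in> eigenvalues M" "l' \<in> eigenvalues M" "l \<noteq> l'" for l l'
  proof -
    have "(M *v V l) \<bullet> V l' = V l \<bullet> (M *v V l')"
      by (metis dot_lmul_matrix sym transpose_matrix_vector)
    then have "(l - l') * (V l \<bullet> V l') = 0"
      using V that by (simp add: algebra_simps)
    then show ?thesis using that by simp
  qed
  have inj: "inj_on V (eigenvalues M)"
    using orth V by (metis inj_onI inner_eq_zero_iff)
  have "pairwise orthogonal (V ` eigenvalues M)"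
    using orth by (auto simp: pairwise_def orthogonal_def) 
  then have "independent (V ` eigenvalues M)"
    using V by (intro pairwise_orthogonal_independent) auto
  then show ?thesis
    using inj finite_imageD independent_imp_finite by blast
qed

text \<open>The Rayleigh quotient of \<open>M\<close> attains its minimum \<mu> over the unit
  vectors of the range \<open>R\<close> of \<open>A\<close>. A minimiser \<open>v\<close> is an
  eigenvector and \<mu> is positive, so \<mu> competes in the \<open>Min\<close> and bounds
  \<open>lambda_min_pos\<close> from above; the estimate with \<mu> on \<open>R\<close> then implies
  the one claimed.\<close>

lemma
  fixes A :: "real^'d^'n"
  assumes "A \<noteq> 0"
  shows lambda_min_pos_gt_0: "0 < lambda_min_pos (A ** transpose A)"
    and lambda_min_pos_le:
      "w \<in> range ((*v) A) \<Longrightarrow>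
        sqrt (lambda_min_pos (A ** transpose A)) * norm w \<le> norm (transpose A *v w)"
proof -
  define M where "M = A ** transpose A"
  define R where "R = range ((*v) A)"
  let ?P = "{l \<in> eigenvalues M. l > 0}"
  have M: "M *v u = A *v (transpose A *v u)" for u
    by (simp add: M_def matrix_vector_mul_assoc del: transpose_matrix_vector)
  have MR: "M *v u \<in> R" for u by (simp add: M R_def)
  have Minner: "(M *v u) \<bullet> w = (transpose A *v u) \<bullet> (transpose A *v w)" for u w
    by (metis M dot_lmul_matrix inner_commute transpose_matrix_vector)
  have sub: "subspace R"
    unfolding R_def by (intro linear_subspace_image) auto
  have "\<exists>u. A *v u \<noteq> 0"
    using assms by (metis matrix_eq matrix_vector_mult_0)
  then obtain e where e: "e \<in> R" "e \<noteq> 0" by (auto simp: R_def)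
  let ?K = "R \<inter> sphere 0 1"
  have "compact ?K"
    by (intro closed_Int_compact closed_subspace sub compact_sphere)
  moreover have "e /\<^sub>R norm e \<in> ?K"
    using e sub by (auto simp: subspace_scale)
  moreover have "continuous_on ?K (\<lambda>u. (norm (transpose A *v u))\<^sup>2)"
    by (intro continuous_intros linear_continuous_on matrix_vector_mul_bounded_linear)
  ultimately obtain v where v: "v \<in> ?K"
      "\<And>u. u \<in> ?K \<Longrightarrow> (norm (transpose A *v v))\<^sup>2 \<le> (norm (transpose A *v u))\<^sup>2"
    using continuous_attains_inf[of ?K "\<lambda>u. (norm (transpose A *v u))\<^sup>2"] by blast
  define \<mu> where "\<mu> = (norm (transpose A *v v))\<^sup>2"
  have min: "\<mu> * (norm u)\<^sup>2 \<le> (norm (transpose A *v u))\<^sup>2" if "u \<in> R" for u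
  proof (cases "u = 0")
    case False
    then have "u /\<^sub>R norm u \<in> ?K" using that sub by (auto simp: subspace_scale)
    from v(2)[OF this] have "\<mu> \<le> (norm (transpose A *v u) / norm u)\<^sup>2"
      using False by (simp add: \<mu>_def matrix_vector_mult_scaleR field_simps)
    then show ?thesis using False by (simp add: field_simps)
  qed simp
  have orth: "(M *v v - \<mu> *\<^sub>R v) \<bullet> w = 0" if "w \<in> R" for w
  proof -
    define c where "c = (M *v v - \<mu> *\<^sub>R v) \<bullet> w"
    have c: "c = (transpose A *v v) \<bullet> (transpose A *v w) - \<mu> * (v \<bullet> w)"
      by (simp only: c_def inner_diff_left Minner inner_scaleR_left)
    define d where "d = (norm (transpose A *v w))\<^sup>2 - \<mu> * (norm w)\<^sup>2"
    \<comment> \<open>Variation of \<open>v\<close> along \<open>w\<close>: the constant term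
      vanishes because \<open>v\<close> attains \<mu>, and a polynomial that stays nonnegative
      without a constant term has no linear term.\<close>
    have q: "0 \<le> 2 * t * c + t\<^sup>2 * d" for t
    proof -
      have "v + t *\<^sub>R w \<in> R" using v(1) that sub by (auto intro: subspace_add subspace_scale)
      from min[OF this] have "0 \<le> (norm (transpose A *v v + t *\<^sub>R (transpose A *v w)))\<^sup>2
          - \<mu> * (norm (v + t *\<^sub>R w))\<^sup>2"
        by (simp add: matrix_vector_right_distrib matrix_vector_mult_scaleR)
      also have "\<dots> = (norm (transpose A *v v))\<^sup>2 - \<mu> * (norm v)\<^sup>2 + 2 * t * c + t\<^sup>2 * d"
        unfolding c d_def power2_norm_eq_inner
        by (simp add: inner_simps algebra_simps power2_eq_square inner_commute
            del: transpose_matrix_vector)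
      also have "(norm (transpose A *v v))\<^sup>2 - \<mu> * (norm v)\<^sup>2 = 0"
        using v(1) by (simp add: \<mu>_def)
      finally show ?thesis by simp
    qed
    have "d \<ge> 0" using min[OF that] by (simp add: d_def)
    \<comment> \<open>At \<open>t = - s\<close> the polynomial equals
      \<open>- (s\<^sup>2 * (d + 2))\<close>; the shift by 1 avoids a division by zero.\<close>
    define s where "s = c / (d + 1)"
    have cs: "c = s * (d + 1)" using \<open>d \<ge> 0\<close> by (simp add: s_def)
    have "0 \<le> - (s\<^sup>2 * (d + 2))"
      using q[of "- s"] by (simp add: cs algebra_simps power2_eq_square)
    moreover have "0 \<le> s\<^sup>2 * (d + 2)" using \<open>d \<ge> 0\<close> by simp
    ultimately have "s\<^sup>2 * (d + 2) = 0" by linarith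
    then have "c = 0" using \<open>d \<ge> 0\<close> cs by simp
    then show ?thesis by (simp add: c_def)
  qed
  \<comment> \<open>The eigenvector residual lies in \<open>R\<close> and is orthogonal to
    \<open>R\<close>, hence vanishes.\<close>
  have "M *v v - \<mu> *\<^sub>R v \<in> R"
    using MR v(1) sub by (auto intro: subspace_diff subspace_scale)
  then have "M *v v = \<mu> *\<^sub>R v" using orth by fastforce
  moreover have "v \<noteq> 0" using v(1) by auto
  moreover have "\<mu> > 0"
  proof (rule ccontr)
    assume "\<not> \<mu> > 0"
    then have "transpose A *v v = 0" by (simp add: \<mu>_def)
    moreover obtain s where "v = A *v s" using v(1) by (auto simp: R_def)
    ultimately have "v \<bullet> v = 0"
      by (metis dot_lmul_matrix inner_zero_left transpose_matrix_vector)
    then show False using \<open>v \<noteq> 0\<close> by simp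
  qed
  ultimately have mu: "\<mu> \<in> ?P" by (auto simp: eigenvalues_def)
  have "transpose M = M" by (simp add: M_def matrix_transpose_mul)
  then have "finite (eigenvalues M)" by (rule finite_eigenvalues_symmetric)
  then have fin: "finite ?P" by (rule rev_finite_subset) auto
  have Min: "lambda_min_pos M = Min ?P" by (simp add: lambda_min_pos_def)
  have "Min ?P \<in> ?P" using mu by (intro Min_in fin) blast
  then show pos: "0 < lambda_min_pos (A ** transpose A)"
    unfolding M_def[symmetric] Min by blast
  have le: "lambda_min_pos M \<le> \<mu>" using Min fin mu by simp
  assume "w \<in> range ((*v) A)"
  then have "\<mu> * (norm w)\<^sup>2 \<le> (norm (transpose A *v w))\<^sup>2"
    by (intro min) (simp only: R_def)
  moreover have "lambda_min_pos M * (norm w)\<^sup>2 \<le> \<mu> * (norm w)\<^sup>2"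
    by (rule mult_right_mono[OF le]) simp
  ultimately have "lambda_min_pos M * (norm w)\<^sup>2 \<le> (norm (transpose A *v w))\<^sup>2"
    by linarith
  moreover have "lambda_min_pos M * (norm w)\<^sup>2 = (sqrt (lambda_min_pos M) * norm w)\<^sup>2"
    using pos unfolding M_def[symmetric] by (simp only: power_mult_distrib real_sqrt_pow2 less_imp_le)
  ultimately show "sqrt (lambda_min_pos (A ** transpose A)) * norm w \<le> norm (transpose A *v w)"
    unfolding M_def[symmetric] by (intro power2_le_imp_le[OF _ norm_ge_zero]) (simp only:)
qed

section \<open>The series of 1 / (n (ln n)^2)\<close>

text \<open>From \<open>ln n - ln (n - 1) \<ge> 1 / n\<close> the term is dominated by a telescoping
  difference. The bound starts at 3 so that \<open>ln (n - 1)\<close> is positive.\<close>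

lemma inverse_ln_diff_ge:
  assumes "n \<ge> 3"
  shows "1 / (real n * (ln (real n))\<^sup>2) \<le> 1 / ln (real n - 1) - 1 / ln (real n)"
proof -
  have n: "real n - 1 \<ge> 2" using assms by simp
  then have l: "0 < ln (real n - 1)" "ln (real n - 1) \<le> ln (real n)" by simp_all
  have "ln ((real n - 1) / real n) \<le> (real n - 1) / real n - 1"
    by (rule ln_le_minus_one) (use n in auto)
  then have d: "1 / real n \<le> ln (real n) - ln (real n - 1)"
    using n by (simp add: ln_div field_simps)
  have "1 / (real n * (ln (real n))\<^sup>2) = (1 / real n) / (ln (real n))\<^sup>2" by simp
  also have "\<dots> \<le> (ln (real n) - ln (real n - 1)) / (ln (real n))\<^sup>2"
    by (rule divide_right_mono[OF d]) simp
  also have "\<dots> \<le> (ln (real n) - ln (real n - 1)) / (ln (real n - 1) * ln (real n))"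
    using l by (intro divide_left_mono) (auto simp: power2_eq_square intro: mult_right_mono)
  also have "\<dots> = 1 / ln (real n - 1) - 1 / ln (real n)"
    using l by (simp add: field_simps)
  finally show ?thesis .
qed

text \<open>The term for \<open>n = 2\<close> is split off and the others telescope to at most
  \<open>1 / ln 2\<close>; with \<open>ln 2 \<ge> 2 / 3\<close> the total is at most 9/8 + 3/2. The
  bound 4 is the factor that later meets the coefficients of \<open>v0 / \<beta>0\<close> in
  \<open>Cx\<close>.\<close>

lemma sum_log_series_le:
  "(\<Sum>k<N. 1 / ((real k + 2) * (ln (real k + 2))\<^sup>2)) \<le> 4"
proof -
  have l2: "ln 2 \<ge> (2/3 :: real)" using ln2_ge_two_thirds .
  have step: "(\<Sum>k<N. 1 / ((real k + 3) * (ln (real k + 3))\<^sup>2)) \<le> 1 / ln 2 - 1 / ln (real N + 2)" for N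
  proof (induction N)
    case (Suc N)
    have "1 / ((real N + 3) * (ln (real N + 3))\<^sup>2) \<le> 1 / ln (real N + 2) - 1 / ln (real N + 3)"
      using inverse_ln_diff_ge[of "N + 3"] by (simp add: algebra_simps)
    with Suc show ?case by (simp add: algebra_simps)
  qed simp
  have "(\<Sum>k<N. 1 / ((real k + 2) * (ln (real k + 2))\<^sup>2))
      \<le> (\<Sum>k<Suc N. 1 / ((real k + 2) * (ln (real k + 2))\<^sup>2))"
    by (intro sum_mono2) auto
  also have "\<dots> = 1 / (2 * (ln 2)\<^sup>2) + (\<Sum>k<N. 1 / ((real k + 3) * (ln (real k + 3))\<^sup>2))"
    by (subst sum.lessThan_Suc_shift) (simp add: algebra_simps)
  also have "\<dots> \<le> 1 / (2 * (ln 2)\<^sup>2) + 1 / ln 2"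
    using step[of N] by (smt (verit, best) divide_nonneg_nonneg ln_ge_zero of_nat_0_le_iff)
  also have "\<dots> \<le> 1 / (2 * (2/3)\<^sup>2) + 1 / (2/3)"
    using l2 by (intro add_mono divide_left_mono mult_left_mono power_mono mult_pos_pos) auto
  also have "\<dots> \<le> (4::real)" by (simp add: power2_eq_square)
  finally show ?thesis .
qed

lemma summable_log_series: "summable (\<lambda>k. 1 / ((real k + 2) * (ln (real k + 2))\<^sup>2))"
  by (rule summableI_nonneg_bounded[where x = 4]) (auto intro: sum_log_series_le)

section \<open>Directional derivatives and the squared positive part\<close>

lemma has_derivative_imp_directional_limit:
  fixes S :: "'a::real_normed_vector \<Rightarrow> real"
  assumes "(S has_derivative S') (at u)"
  shows "((\<lambda>t. (S (u + t *\<^sub>R d) - S u) / t) \<longlongrightarrow> S' d) (at_right 0)"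
proof -
  have 1: "((\<lambda>t. u + t *\<^sub>R d) has_derivative (\<lambda>t. t *\<^sub>R d)) (at (0::real))"
    by (auto intro!: derivative_eq_intros)
  have "((\<lambda>t. S (u + t *\<^sub>R d)) has_derivative (\<lambda>t. S' (t *\<^sub>R d))) (at (0::real))"
    using diff_chain_at[OF 1, of S S'] assms by (simp add: o_def)
  moreover have "S' (t *\<^sub>R d) = S' d * t" for t
    using assms has_derivative_bounded_linear linear_simps(5) by fastforce
  ultimately have "((\<lambda>t. S (u + t *\<^sub>R d)) has_real_derivative S' d) (at 0)"
    by (simp add: has_field_derivative_def)
  then have "((\<lambda>t. (S (u + t *\<^sub>R d) - S u) / t) \<longlongrightarrow> S' d) (at 0)"
    by (simp add: DERIV_def)
  then show ?thesis by (rule filterlim_mono) (auto intro: at_le)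
qed

text \<open>Squaring removes the kink: at 0 the difference quotient is at most
  \<open>\<bar>h\<bar>\<close> in absolute value.\<close>

lemma has_real_derivative_pos_part_squared:
  "((\<lambda>t. (max t 0)\<^sup>2) has_real_derivative 2 * max s 0) (at (s::real))"
proof (cases s "0::real" rule: linorder_cases)
  case less
  have "((\<lambda>t. 0) has_real_derivative 0) (at s)" by simp
  then have "((\<lambda>t. (max t 0)\<^sup>2) has_real_derivative 0) (at s)"
    by (rule DERIV_cong_ev[THEN iffD1, rotated -1])
       (use less eventually_at_topological in \<open>auto intro!: exI[of _ "{..<0}"] simp: eventually_nhds\<close>)
  then show ?thesis using less by simp
next
  case greater
  have "((\<lambda>t. t\<^sup>2) has_real_derivative 2 * s) (at s)"
    by (auto intro!: derivative_eq_intros)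
  then have "((\<lambda>t. (max t 0)\<^sup>2) has_real_derivative 2 * s) (at s)"
    by (rule DERIV_cong_ev[THEN iffD1, rotated -1])
       (use greater in \<open>auto intro!: exI[of _ "{0<..}"] simp: eventually_nhds\<close>)
  then show ?thesis using greater by simp
next
  case equal
  have "((\<lambda>h::real. (max h 0)\<^sup>2 / h) \<longlongrightarrow> 0) (at 0)"
  proof (rule Lim_null_comparison)
    show "\<forall>\<^sub>F h::real in at 0. norm ((max h 0)\<^sup>2 / h) \<le> \<bar>h\<bar>"
      by (rule always_eventually) (auto simp: max_def power2_eq_square)
    show "((\<lambda>h::real. \<bar>h\<bar>) \<longlongrightarrow> 0) (at 0)"
      using tendsto_rabs[OF tendsto_ident_at[of "0::real" UNIV]] by simp
  qed
  then show ?thesis using equal by (simp add: DERIV_def)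
qed

lemma pos_part_squared_above_tangent:
  "(max s 0)\<^sup>2 + 2 * max s 0 * (t - s) \<le> (max t 0)\<^sup>2" for s t :: real
proof (cases "s \<le> 0")
  case False
  then show ?thesis
    using zero_le_power2[of "s - t"]
    by (cases "t \<le> 0") (auto simp: max_def power2_eq_square algebra_simps
        intro: order_trans[OF mult_left_mono])
qed simp

lemma convex_on_above_tangent:
  fixes S :: "'a::real_normed_vector \<Rightarrow> real"
  assumes conv: "convex_on X S" and der: "(S has_derivative S') (at u)" and uw: "u \<in> X" "w \<in> X"
  shows "S u + S' (w - u) \<le> S w"
proof -
  have "\<forall>\<^sub>F t in at_right (0::real). (S (u + t *\<^sub>R (w - u)) - S u) / t \<le> S w - S u"
  proof (rule eventually_at_rightI[where b = 1])
    fix t :: real assume t: "t \<in> {0<..<1}"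
    have "S ((1 - t) *\<^sub>R u + t *\<^sub>R w) \<le> (1 - t) * S u + t * S w"
      using conv uw t by (auto simp: convex_on_def)
    also have "(1 - t) *\<^sub>R u + t *\<^sub>R w = u + t *\<^sub>R (w - u)" by (simp add: algebra_simps)
    finally show "(S (u + t *\<^sub>R (w - u)) - S u) / t \<le> S w - S u"
      using t by (simp add: field_simps)
  qed simp
  from tendsto_upperbound[OF has_derivative_imp_directional_limit[OF der] this]
  show ?thesis by simp
qed

section \<open>First-order conditions for the proximal subproblem\<close>

lemma pos_part_nth [simp]: "pos_part a $ i = max (a $ i) 0"
  by (simp add: pos_part_def)

lemma norm_squared_eq_sum: "(norm (a :: real^'m))\<^sup>2 = (\<Sum>i\<in>UNIV. (a $ i)\<^sup>2)"
  unfolding power2_norm_eq_inner inner_vec_def by (simp add: power2_eq_square)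

lemma transpose_matrix_inner: "(transpose M *v w) \<bullet> d = w \<bullet> (M *v d)" for M :: "real^'d^'n"
  by (simp add: dot_lmul_matrix)

lemma norm_pos_part_squared_eq_sum:
  "(norm (pos_part (a + z /\<^sub>R \<beta>)))\<^sup>2 = (\<Sum>i\<in>UNIV. (max (a $ i + z $ i / \<beta>) 0)\<^sup>2)"
  by (simp add: norm_squared_eq_sum divide_inverse_commute)

lemma norm_pos_part_diff_le: "norm (pos_part a - pos_part b) \<le> norm (a - b)"
  by (rule norm_le_componentwise_cart) (auto simp: max_def)

definition eq_multiplier :: "real^'d^'n \<Rightarrow> real^'n \<Rightarrow> real \<Rightarrow> real^'n \<Rightarrow> real^'d \<Rightarrow> real^'n" where
  "eq_multiplier A b \<beta> y u = y + \<beta> *\<^sub>R (A *v u - b)"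

text \<open>The undamped update \<open>z + \<beta> max(- z / \<beta>, g u)\<close> for \<beta> > 0,
  in a form in which nonnegativity is immediate and dependence on \<open>u\<close> is visibly
  nonexpansive in \<open>\<beta> g u\<close>.\<close>

definition ineq_multiplier :: "(real^'d \<Rightarrow> real^'m) \<Rightarrow> real \<Rightarrow> real^'m \<Rightarrow> real^'d \<Rightarrow> real^'m" where
  "ineq_multiplier g \<beta> z u = pos_part (z + \<beta> *\<^sub>R g u)"

text \<open>The real-valued core, with \<phi> standing for \<open>F\<close> on its domain
  \<open>X\<close>. In \<open>\<phi>_slope\<close> only \<open>p\<close> must be interior: the rise
  from a boundary point into the interior is controlled, while the opposite direction may be
  arbitrarily steep.\<close>

locale weakly_convex_program =
  fixes \<phi> :: "real^'d \<Rightarrow> real" and X :: "(real^'d) set"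
    and A :: "real^'d^'n" and b :: "real^'n" and g :: "real^'d \<Rightarrow> real^'m"
    and \<rho> C B_g :: real and xfeas :: "real^'d"
  assumes X_compact: "compact X" and X_convex: "convex X"
    and \<phi>_cont: "continuous_on X \<phi>"
    and \<rho>_pos: "\<rho> > 0"
    and \<phi>_weakly_convex: "\<And>u w t. \<lbrakk>u \<in> X; w \<in> X; 0 \<le> t; t \<le> 1\<rbrakk> \<Longrightarrow>
      \<phi> (u + t *\<^sub>R (w - u)) \<le> (1 - t) * \<phi> u + t * \<phi> w + \<rho> / 2 * t * (1 - t) * (norm (w - u))\<^sup>2"
    and \<phi>_slope: "\<And>p q. \<lbrakk>p \<in> interior X; q \<in> X\<rbrakk> \<Longrightarrow>
      \<phi> p - \<phi> q \<le> C * norm (p - q) + \<rho> / 2 * (norm (p - q))\<^sup>2"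
    and C_nonneg: "0 \<le> C"
    and g_diff: "\<And>u. u \<in> X \<Longrightarrow> g differentiable (at u)"
    and g_convex: "\<And>i. convex_on X (\<lambda>u. g u $ i)"
    and B_g_pos: "B_g > 0"
    and g_lip: "\<And>u w i. \<lbrakk>u \<in> X; w \<in> X\<rbrakk> \<Longrightarrow> \<bar>g u $ i - g w $ i\<bar> \<le> B_g * norm (u - w)"
    and xfeas_interior: "xfeas \<in> interior X" and xfeas_eq: "A *v xfeas = b"
begin

definition smooth_part :: "real \<Rightarrow> real^'n \<Rightarrow> real^'m \<Rightarrow> real^'d \<Rightarrow> real" where
  "smooth_part \<beta> y z u = y \<bullet> (A *v u - b) + \<beta> / 2 * (norm (A *v u - b))\<^sup>2
     + \<beta> / 2 * (norm (pos_part (g u + z /\<^sub>R \<beta>)))\<^sup>2 - (norm z)\<^sup>2 / (2 * \<beta>)"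

definition lagr :: "real \<Rightarrow> real^'n \<Rightarrow> real^'m \<Rightarrow> real^'d \<Rightarrow> real" where
  "lagr \<beta> y z u = \<phi> u + smooth_part \<beta> y z u"

definition prox_minimizer :: "real^'d \<Rightarrow> real \<Rightarrow> real^'n \<Rightarrow> real^'m \<Rightarrow> real^'d \<Rightarrow> bool" where
  "prox_minimizer c \<beta> y z u \<longleftrightarrow> u \<in> X \<and>
     (\<forall>w\<in>X. lagr \<beta> y z u + \<rho> * (norm (u - c))\<^sup>2 \<le> lagr \<beta> y z w + \<rho> * (norm (w - c))\<^sup>2)"

text \<open>The gradient of \<open>smooth_part\<close>, written through the fully updated
  multipliers: in this form the optimality condition of a subproblem is already a KKT condition for
  them.\<close>

definition lagr_grad :: "real \<Rightarrow> real^'n \<Rightarrow> real^'m \<Rightarrow> real^'d \<Rightarrow> real^'d" where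
  "lagr_grad \<beta> y z u = transpose (jacobian g (at u)) *v ineq_multiplier g \<beta> z u
     + transpose A *v eq_multiplier A b \<beta> y u"

lemma xfeas_in_X: "xfeas \<in> X"
  using xfeas_interior interior_subset by blast

lemma g_has_derivative:
  assumes "u \<in> X"
  shows "(g has_derivative (\<lambda>d. jacobian g (at u) *v d)) (at u)"
  using g_diff[OF assms] jacobian_works by blast

lemma g_component_has_derivative:
  assumes "u \<in> X"
  shows "((\<lambda>u. g u $ i) has_derivative (\<lambda>d. (jacobian g (at u) *v d) $ i)) (at u)"
  using g_has_derivative[OF assms]
  by (rule bounded_linear.has_derivative[OF bounded_linear_vec_nth])

lemma g_above_tangent:
  assumes "u \<in> X" "w \<in> X"
  shows "g u $ i + (jacobian g (at u) *v (w - u)) $ i \<le> g w $ i"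
  by (rule convex_on_above_tangent[OF g_convex g_component_has_derivative]) fact+

lemma lagr_grad_inner:
  "lagr_grad \<beta> y z u \<bullet> d = eq_multiplier A b \<beta> y u \<bullet> (A *v d)
     + (\<Sum>i\<in>UNIV. ineq_multiplier g \<beta> z u $ i * (jacobian g (at u) *v d) $ i)"
  unfolding lagr_grad_def inner_add_left transpose_matrix_inner
  by (simp add: inner_vec_def[of "ineq_multiplier g \<beta> z u"])

lemma smooth_part_has_derivative:
  assumes u: "u \<in> X" and "\<beta> > 0"
  shows "(smooth_part \<beta> y z has_derivative (\<lambda>d. lagr_grad \<beta> y z u \<bullet> d)) (at u)"
proof -
  have lin: "((\<lambda>u. A *v u - b) has_derivative (\<lambda>d. A *v d)) (at u)"
    by (auto intro!: derivative_eq_intros bounded_linear_imp_has_derivative)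
  have 1: "((\<lambda>u. y \<bullet> (A *v u - b)) has_derivative (\<lambda>d. y \<bullet> (A *v d))) (at u)"
    using lin by (rule has_derivative_inner_right)
  have 2: "((\<lambda>u. \<beta> / 2 * (norm (A *v u - b))\<^sup>2) has_derivative
      (\<lambda>d. \<beta> * ((A *v u - b) \<bullet> (A *v d)))) (at u)"
    unfolding power2_norm_eq_inner
    by (rule has_derivative_eq_rhs[OF has_derivative_mult_right[OF has_derivative_inner[OF lin lin]]])
       (auto simp: inner_commute)
  have 3: "((\<lambda>u. (max (g u $ i + z $ i / \<beta>) 0)\<^sup>2) has_derivative
      (\<lambda>d. (jacobian g (at u) *v d) $ i * (2 * max (g u $ i + z $ i / \<beta>) 0))) (at u)" for i
    by (rule DERIV_compose_FDERIV[OF has_real_derivative_pos_part_squared])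
       (auto intro!: derivative_eq_intros g_component_has_derivative[OF u])
  have 4: "((\<lambda>u. \<Sum>i\<in>UNIV. (max (g u $ i + z $ i / \<beta>) 0)\<^sup>2) has_derivative
      (\<lambda>d. \<Sum>i\<in>UNIV. (jacobian g (at u) *v d) $ i * (2 * max (g u $ i + z $ i / \<beta>) 0))) (at u)"
    by (rule has_derivative_sum) (rule 3)
  have m: "\<beta> * max (g u $ i + z $ i / \<beta>) 0 = ineq_multiplier g \<beta> z u $ i" for i
    using \<open>\<beta> > 0\<close> by (simp add: ineq_multiplier_def max_mult_distrib_left algebra_simps)
  have "(smooth_part \<beta> y z has_derivative
     (\<lambda>d. y \<bullet> (A *v d) + \<beta> * ((A *v u - b) \<bullet> (A *v d))
       + \<beta> / 2 * (\<Sum>i\<in>UNIV. (jacobian g (at u) *v d) $ i * (2 * max (g u $ i + z $ i / \<beta>) 0)) - 0)) (at u)"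
    unfolding smooth_part_def[abs_def] norm_pos_part_squared_eq_sum
    by (intro has_derivative_add has_derivative_diff has_derivative_mult_right has_derivative_const 1 2 4)
  moreover have "\<beta> / 2 * (\<Sum>i\<in>UNIV. (jacobian g (at u) *v d) $ i * (2 * max (g u $ i + z $ i / \<beta>) 0))
      = (\<Sum>i\<in>UNIV. ineq_multiplier g \<beta> z u $ i * (jacobian g (at u) *v d) $ i)" for d
    unfolding sum_distrib_left m[symmetric] by (intro sum.cong) auto
  ultimately show ?thesis
    by (simp add: lagr_grad_inner eq_multiplier_def inner_add_left)
qed

text \<open>Two tangent inequalities are chained in each inequality constraint: that of
  \<open>g\<close>, weighted by a nonnegative multiplier, and that of the squared positive
  part.\<close>

lemma smooth_part_above_tangent:
  assumes u: "u \<in> X" and w: "w \<in> X" and \<beta>: "\<beta> > 0"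
  shows "smooth_part \<beta> y z u + lagr_grad \<beta> y z u \<bullet> (w - u) \<le> smooth_part \<beta> y z w"
proof -
  let ?r = "A *v u - b" and ?r' = "A *v w - b" and ?J = "jacobian g (at u)"
  have rr: "?r' = ?r + A *v (w - u)" by (simp add: matrix_vector_mult_diff_distrib)
  have 1: "y \<bullet> ?r + y \<bullet> (A *v (w - u)) = y \<bullet> ?r'" by (simp add: rr inner_simps)
  have "(norm ?r)\<^sup>2 + 2 * (?r \<bullet> (A *v (w - u))) \<le> (norm ?r')\<^sup>2"
    unfolding rr power2_norm_eq_inner
    by (simp only: inner_add_left inner_add_right) (simp add: inner_commute)
  from mult_left_mono[OF this, of "\<beta> / 2"] \<beta>
  have 2: "\<beta> / 2 * (norm ?r)\<^sup>2 + \<beta> * (?r \<bullet> (A *v (w - u))) \<le> \<beta> / 2 * (norm ?r')\<^sup>2"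
    by (simp add: algebra_simps)
  have 3: "\<beta> / 2 * (max (g u $ i + z $ i / \<beta>) 0)\<^sup>2 + ineq_multiplier g \<beta> z u $ i * (?J *v (w - u)) $ i
      \<le> \<beta> / 2 * (max (g w $ i + z $ i / \<beta>) 0)\<^sup>2" for i
  proof -
    let ?s = "g u $ i + z $ i / \<beta>" and ?t = "g w $ i + z $ i / \<beta>"
    have m: "ineq_multiplier g \<beta> z u $ i = \<beta> * max ?s 0"
      using \<beta> by (simp add: ineq_multiplier_def max_mult_distrib_left algebra_simps)
    have "\<beta> * max ?s 0 * (?J *v (w - u)) $ i \<le> \<beta> * max ?s 0 * (?t - ?s)"
      using g_above_tangent[OF u w, of i] \<beta> by (intro mult_left_mono) auto
    moreover have "\<beta> / 2 * ((max ?s 0)\<^sup>2 + 2 * max ?s 0 * (?t - ?s)) \<le> \<beta> / 2 * (max ?t 0)\<^sup>2"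
      using \<beta> by (intro mult_left_mono pos_part_squared_above_tangent) auto
    ultimately show ?thesis unfolding m by (simp add: algebra_simps)
  qed
  have 4: "\<beta> / 2 * (norm (pos_part (g u + z /\<^sub>R \<beta>)))\<^sup>2
        + (\<Sum>i\<in>UNIV. ineq_multiplier g \<beta> z u $ i * (?J *v (w - u)) $ i)
      \<le> \<beta> / 2 * (norm (pos_part (g w + z /\<^sub>R \<beta>)))\<^sup>2"
    unfolding norm_pos_part_squared_eq_sum sum_distrib_left sum.distrib[symmetric]
    by (intro sum_mono 3)
  from 1 2 4 show ?thesis
    by (simp add: smooth_part_def lagr_grad_inner eq_multiplier_def inner_add_left)
qed

section \<open>Existence and optimality of the exact minimiser\<close>

lemma prox_minimizer_exists:
  assumes \<beta>: "\<beta> > 0"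
  obtains u where "prox_minimizer c \<beta> y z u"
proof -
  have "continuous_on X (\<lambda>u. lagr \<beta> y z u + \<rho> * (norm (u - c))\<^sup>2)"
    unfolding lagr_def
    by (intro continuous_intros \<phi>_cont differentiable_imp_continuous_on)
       (auto simp: differentiable_on_def differentiable_def
         intro!: has_derivative_at_withinI[OF smooth_part_has_derivative] \<beta>)
  from continuous_attains_inf[OF X_compact _ this] xfeas_in_X that
  show ?thesis by (auto simp: prox_minimizer_def)
qed

text \<open>Common source of the next two inequalities. \<kappa> bounds the slope of \<phi> from
  \<open>u\<close> towards \<open>w\<close>; the term with \<kappa>' disappears when the optimality
  inequality is divided by \<open>t\<close> and \<open>t\<close> tends to 0.\<close>

lemma prox_minimizer_first_order:
  assumes min: "prox_minimizer c \<beta> y z u" and \<beta>: "\<beta> > 0" and w: "w \<in> X"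
    and \<phi>: "\<And>t. 0 < t \<Longrightarrow> t < 1 \<Longrightarrow> \<phi> (u + t *\<^sub>R (w - u)) - \<phi> u \<le> t * \<kappa> + t\<^sup>2 * \<kappa>'"
  shows "0 \<le> \<kappa> + (lagr_grad \<beta> y z u + (2 * \<rho>) *\<^sub>R (u - c)) \<bullet> (w - u)"
proof -
  have u: "u \<in> X" using min by (simp add: prox_minimizer_def)
  define S where "S v = smooth_part \<beta> y z v + \<rho> * (norm (v - c))\<^sup>2" for v
  let ?G = "lagr_grad \<beta> y z u + (2 * \<rho>) *\<^sub>R (u - c)"
  have "(S has_derivative (\<lambda>d. ?G \<bullet> d)) (at u)"
    unfolding S_def[abs_def] power2_norm_eq_inner
    by (rule has_derivative_eq_rhs, rule has_derivative_add[OF smooth_part_has_derivative[OF u \<beta>]],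
        rule derivative_intros, rule has_derivative_inner) 
       (auto intro!: derivative_eq_intros simp: inner_simps inner_commute)
  then have lim: "((\<lambda>t. (S (u + t *\<^sub>R (w - u)) - S u) / t) \<longlongrightarrow> ?G \<bullet> (w - u)) (at_right 0)"
    by (rule has_derivative_imp_directional_limit)
  have "((\<lambda>t. \<kappa> + t * \<kappa>' + (S (u + t *\<^sub>R (w - u)) - S u) / t) \<longlongrightarrow> \<kappa> + 0 * \<kappa>' + ?G \<bullet> (w - u)) (at_right 0)"
    by (intro tendsto_intros lim)
  moreover have "\<forall>\<^sub>F t in at_right (0::real). 0 \<le> \<kappa> + t * \<kappa>' + (S (u + t *\<^sub>R (w - u)) - S u) / t"
  proof (rule eventually_at_rightI[where b = 1])
    fix t :: real assume t: "t \<in> {0<..<1}"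
    have "(1 - t) *\<^sub>R u + t *\<^sub>R w \<in> X" using X_convex u w t by (auto simp: convex_def)
    then have "u + t *\<^sub>R (w - u) \<in> X" by (simp add: algebra_simps)
    then have "\<phi> u + S u \<le> \<phi> (u + t *\<^sub>R (w - u)) + S (u + t *\<^sub>R (w - u))"
      using min by (auto simp: prox_minimizer_def S_def lagr_def add.assoc)
    with \<phi>[of t] t have "0 \<le> t * \<kappa> + t\<^sup>2 * \<kappa>' + (S (u + t *\<^sub>R (w - u)) - S u)" by auto
    then have "0 \<le> (t * \<kappa> + t\<^sup>2 * \<kappa>' + (S (u + t *\<^sub>R (w - u)) - S u)) / t" using t by auto
    then show "0 \<le> \<kappa> + t * \<kappa>' + (S (u + t *\<^sub>R (w - u)) - S u) / t"
      using t by (simp add: field_simps power2_eq_square)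
  qed simp
  ultimately show ?thesis
    using tendsto_lowerbound[of _ _ "at_right (0::real)" 0] by fastforce
qed

text \<open>The chord inequality of weak convexity supplies \<kappa> with the values of \<phi> and,
  through \<open>t * (1 - t)\<close>, the second-order term.\<close>

lemma prox_minimizer_variational:
  assumes min: "prox_minimizer c \<beta> y z u" and \<beta>: "\<beta> > 0" and w: "w \<in> X"
  shows "0 \<le> \<phi> w - \<phi> u + \<rho> / 2 * (norm (w - u))\<^sup>2
    + (lagr_grad \<beta> y z u + (2 * \<rho>) *\<^sub>R (u - c)) \<bullet> (w - u)"
proof (rule prox_minimizer_first_order[OF assms])
  fix t :: real assume t: "0 < t" "t < 1"
  have "u \<in> X" using min by (simp add: prox_minimizer_def)
  from \<phi>_weakly_convex[OF this w, of t] t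
  show "\<phi> (u + t *\<^sub>R (w - u)) - \<phi> u
    \<le> t * (\<phi> w - \<phi> u + \<rho> / 2 * (norm (w - u))\<^sup>2) + t\<^sup>2 * (- \<rho> / 2 * (norm (w - u))\<^sup>2)"
    by (simp add: algebra_simps power2_eq_square diff_divide_distrib)
qed

text \<open>Here \<kappa> contains no values of \<phi>. Although \<open>u\<close> may lie on the
  boundary, the points \<open>u + t *\<^sub>R (w - u)\<close> with \<open>t > 0\<close> are
  interior, so the slope bound applies to them.\<close>

lemma prox_minimizer_slope:
  assumes min: "prox_minimizer c \<beta> y z u" and \<beta>: "\<beta> > 0" and w: "w \<in> interior X"
  shows "0 \<le> C * norm (w - u) + (lagr_grad \<beta> y z u + (2 * \<rho>) *\<^sub>R (u - c)) \<bullet> (w - u)"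
proof (rule prox_minimizer_first_order[OF min \<beta>])
  show "w \<in> X" using w interior_subset by blast
  fix t :: real assume t: "0 < t" "t < 1"
  have u: "u \<in> X" using min by (simp add: prox_minimizer_def)
  have "u - t *\<^sub>R (u - w) \<in> interior X"
    using mem_interior_convex_shrink[OF X_convex w u] t by simp
  then have "u + t *\<^sub>R (w - u) \<in> interior X" by (simp add: algebra_simps)
  from \<phi>_slope[OF this u]
  have "\<phi> (u + t *\<^sub>R (w - u)) - \<phi> u \<le> C * norm (t *\<^sub>R (w - u)) + \<rho> / 2 * (norm (t *\<^sub>R (w - u)))\<^sup>2"
    by (simp only: add_diff_cancel_left')
  also have "\<dots> = t * (C * norm (w - u)) + t\<^sup>2 * (\<rho> / 2 * (norm (w - u))\<^sup>2)"
    using t by (simp add: power_mult_distrib)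
  finally show "\<phi> (u + t *\<^sub>R (w - u)) - \<phi> u \<le> t * (C * norm (w - u)) + t\<^sup>2 * (\<rho> / 2 * (norm (w - u))\<^sup>2)" .
qed

text \<open>Expanding the proximal term around \<open>u\<close> gains
  \<open>\<rho> * (norm (w - u))\<^sup>2\<close>, of which the variational inequality takes back
  half. An excess of \<open>(\<epsilon>s k)\<^sup>2 / \<rho>\<close> over the minimum therefore
  means a distance of at most \<open>\<delta> k\<close>.\<close>

lemma prox_minimizer_quadratic_growth:
  assumes min: "prox_minimizer c \<beta> y z u" and \<beta>: "\<beta> > 0" and w: "w \<in> X"
  shows "lagr \<beta> y z u + \<rho> * (norm (u - c))\<^sup>2 + \<rho> / 2 * (norm (w - u))\<^sup>2
    \<le> lagr \<beta> y z w + \<rho> * (norm (w - c))\<^sup>2"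
proof -
  have u: "u \<in> X" using min by (simp add: prox_minimizer_def)
  have "(norm ((u - c) + (w - u)))\<^sup>2
      = (norm (u - c))\<^sup>2 + 2 * ((u - c) \<bullet> (w - u)) + (norm (w - u))\<^sup>2"
    unfolding power2_norm_eq_inner inner_add_left inner_add_right
    by (simp add: inner_commute[of "w - u" "u - c"])
  then have "(norm (w - c))\<^sup>2
      = (norm (u - c))\<^sup>2 + 2 * ((u - c) \<bullet> (w - u)) + (norm (w - u))\<^sup>2"
    by simp
  then have "\<rho> * (norm (w - c))\<^sup>2
      = \<rho> * (norm (u - c))\<^sup>2 + 2 * \<rho> * ((u - c) \<bullet> (w - u)) + \<rho> * (norm (w - u))\<^sup>2"
    by (simp only: distrib_left mult_ac)
  then show ?thesis
    using smooth_part_above_tangent[OF u w \<beta>, of y z] prox_minimizer_variational[OF assms]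
    by (simp add: lagr_def inner_add_left)
qed

end

section \<open>Bounds on multipliers and penalty updates\<close>

lemma norm_Pair_mono:
  fixes a c :: "'a::real_normed_vector" and b d :: "'b::real_normed_vector"
  assumes "norm a \<le> norm c" "norm b \<le> norm d"
  shows "norm (a, b) \<le> norm (c, d)"
  using assms by (simp add: norm_Pair add_mono power_mono)

lemma constraint_violation_eq: "constraint_violation A b g u = norm (A *v u - b, pos_part (g u))"
  by (simp add: constraint_violation_def norm_Pair)

lemma constraint_violation_nonneg: "0 \<le> constraint_violation A b g u"
  by (simp add: constraint_violation_def)

lemma constraint_violation_squared:
  "(constraint_violation A b g u)\<^sup>2 = (norm (A *v u - b))\<^sup>2 + (norm (pos_part (g u)))\<^sup>2"
  by (simp add: constraint_violation_def)

lemma ineq_multiplier_nonneg [simp]: "0 \<le> ineq_multiplier g \<beta> z u $ i"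
  by (simp add: ineq_multiplier_def)

text \<open>A full step changes the equality multiplier by exactly \<beta> times the residual, and
  the same holds in every coordinate with \<open>g u $ i \<ge> 0\<close>, as \<open>z\<close> is
  nonnegative there; elsewhere the positive part is 0. Bounded multipliers thus mean infeasibility
  of order \<open>1 / \<beta>\<close>.\<close>

lemma constraint_violation_le_multiplier_change:
  assumes "\<beta> > 0" and z: "\<And>i. 0 \<le> z $ i"
  shows "\<beta> * constraint_violation A b g u
    \<le> norm (eq_multiplier A b \<beta> y u - y, ineq_multiplier g \<beta> z u - z)"
proof -
  have "\<beta> * constraint_violation A b g u = norm (\<beta> *\<^sub>R (A *v u - b, pos_part (g u)))"
    using assms by (simp only: constraint_violation_eq norm_scaleR abs_of_pos)
  also have "\<dots> = norm (\<beta> *\<^sub>R (A *v u - b), \<beta> *\<^sub>R pos_part (g u))"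
    by (simp only: scaleR_Pair)
  also have "\<dots> \<le> norm (eq_multiplier A b \<beta> y u - y, ineq_multiplier g \<beta> z u - z)"
  proof (rule norm_Pair_mono)
    show "norm (\<beta> *\<^sub>R pos_part (g u)) \<le> norm (ineq_multiplier g \<beta> z u - z)"
    proof (rule norm_le_componentwise_cart)
      fix i
      show "norm ((\<beta> *\<^sub>R pos_part (g u)) $ i) \<le> norm ((ineq_multiplier g \<beta> z u - z) $ i)"
        using assms z[of i] by (cases "0 \<le> g u $ i") (simp_all add: ineq_multiplier_def)
    qed
  qed (simp add: eq_multiplier_def)
  finally show ?thesis .
qed

text \<open>Wherever the new multiplier is nonzero, its increment is
  \<open>\<beta> * g u $ i\<close>; the other coordinates contribute nothing. The rest is
  Cauchy-Schwarz.\<close>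

lemma ineq_multiplier_complementarity:
  assumes "\<beta> > 0" and z: "\<And>i. 0 \<le> z $ i"
  shows "\<beta> * (\<Sum>i\<in>UNIV. \<bar>ineq_multiplier g \<beta> z u $ i * g u $ i\<bar>)
    \<le> norm (ineq_multiplier g \<beta> z u) * norm (ineq_multiplier g \<beta> z u - z)"
proof -
  let ?z = "ineq_multiplier g \<beta> z u"
  have "\<beta> * (\<Sum>i\<in>UNIV. \<bar>?z $ i * g u $ i\<bar>) = (\<Sum>i\<in>UNIV. \<bar>?z $ i\<bar> * \<bar>(?z - z) $ i\<bar>)"
    unfolding sum_distrib_left
  proof (rule sum.cong)
    fix i
    show "\<beta> * \<bar>?z $ i * g u $ i\<bar> = \<bar>?z $ i\<bar> * \<bar>(?z - z) $ i\<bar>"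
      using \<open>\<beta> > 0\<close> by (cases "0 \<le> z $ i + \<beta> * g u $ i") (simp_all add: ineq_multiplier_def abs_mult)
  qed simp
  also have "\<dots> \<le> norm ?z * norm (?z - z)"
    using L2_set_mult_ineq[of "\<lambda>i. norm (?z $ i)" "\<lambda>i. norm ((?z - z) $ i)" UNIV]
    by (simp add: norm_vec_def)
  finally show ?thesis .
qed

lemma norm_matrix_vector_le_spectral: "norm (M *v u) \<le> spectral_norm M * norm u"
  unfolding spectral_norm_def by (rule onorm) simp

lemma spectral_norm_nonneg: "0 \<le> spectral_norm M"
  unfolding spectral_norm_def by (rule onorm_pos_le) simp

text \<open>For \<open>g > 0\<close> both positive parts are active: the coefficient 3/2 collects
  \<alpha> from \<open>g * z'\<close> and half of \<alpha> from \<open>z'\<^sup>2 / \<beta>\<close>.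
  For \<open>g \<le> 0\<close> the step does not increase \<open>z\<close>, and as long as
  \<open>\<bar>g\<bar> \<le> z / \<beta>\<close> the value
  \<open>\<beta> / 2 * (g + z / \<beta>)\<^sup>2\<close> decreases in \<beta>.\<close>

lemma pos_part_penalty_update_le:
  fixes g z \<alpha> \<beta> \<beta>' :: real
  assumes z: "0 \<le> z" and \<alpha>: "0 \<le> \<alpha>" "\<alpha> \<le> \<beta>" and \<beta>: "0 < \<beta>" "\<beta> \<le> \<beta>'"
    and z': "z' = z + \<alpha> * max (- z / \<beta>) g"
  shows "\<beta>' / 2 * (max (g + z' / \<beta>') 0)\<^sup>2 \<le> \<beta> / 2 * (max (g + z / \<beta>) 0)\<^sup>2
    + ((\<beta>' - \<beta>) / 2 + 3 / 2 * \<alpha>) * (max g 0)\<^sup>2 + \<alpha> / \<beta> * (z * max g 0)"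
proof -
  have expand: "c / 2 * (g + w / c)\<^sup>2 = c / 2 * g\<^sup>2 + g * w + w\<^sup>2 / c / 2" if "0 < c" for c w
    using that by (simp add: power2_eq_square field_simps)
  show ?thesis
  proof (cases "0 < g")
    case True
    have "- z / \<beta> \<le> 0" using z \<beta> by simp
    then have d: "z' = z + \<alpha> * g" using True z' by simp
    have "z'\<^sup>2 / \<beta>' \<le> z'\<^sup>2 / \<beta>" using \<beta> by (intro divide_left_mono) auto
    also have "\<dots> = z\<^sup>2 / \<beta> + 2 * (\<alpha> / \<beta> * (z * g)) + \<alpha> / \<beta> * (\<alpha> * g\<^sup>2)"
      using \<beta> by (simp add: d power2_sum power_mult_distrib field_simps power2_eq_square)
    also have "\<dots> \<le> z\<^sup>2 / \<beta> + 2 * (\<alpha> / \<beta> * (z * g)) + 1 * (\<alpha> * g\<^sup>2)"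
      using \<alpha> \<beta> by (intro add_left_mono mult_right_mono) auto
    finally have 1: "z'\<^sup>2 / \<beta>' \<le> z\<^sup>2 / \<beta> + 2 * (\<alpha> / \<beta> * (z * g)) + \<alpha> * g\<^sup>2" by simp
    \<comment> \<open>Linear skeleton of the estimate: \<open>p\<close>, \<open>q\<close> stand for
      the terms in \<open>g\<^sup>2\<close>, \<open>s\<close>, \<open>s'\<close> for
      \<open>g * z\<close> and \<open>g * z'\<close>, \<open>Z\<close>, \<open>Z'\<close> for
      \<open>z\<^sup>2 / \<beta>\<close> and \<open>z'\<^sup>2 / \<beta>'\<close>, \<open>e\<close>
      for \<open>\<alpha> * g\<^sup>2\<close> and \<open>M\<close> for the mixed term.\<close>
    have comb: "u \<le> v + k + M" if "u = p + s' + Z' / 2" "v = q + s + Z / 2"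
      "s' = s + e" "k = p - q + 3 / 2 * e" "Z' \<le> Z + 2 * M + e" for u v k M p q s s' Z Z' e :: real
      using that by linarith
    have "0 \<le> z'" using d z \<alpha> True by simp
    then have "g + z' / \<beta>' > 0" "g + z / \<beta> > 0" using True z \<beta> by (auto intro: add_pos_nonneg)
    moreover have "\<beta>' / 2 * (g + z' / \<beta>')\<^sup>2 \<le> \<beta> / 2 * (g + z / \<beta>)\<^sup>2
        + ((\<beta>' - \<beta>) / 2 + 3 / 2 * \<alpha>) * g\<^sup>2 + \<alpha> / \<beta> * (z * g)"
    proof -
      have "g * z' = g * z + \<alpha> * g\<^sup>2" by (simp add: d algebra_simps power2_eq_square)
      moreover have "((\<beta>' - \<beta>) / 2 + 3 / 2 * \<alpha>) * g\<^sup>2 = \<beta>' / 2 * g\<^sup>2 - \<beta> / 2 * g\<^sup>2 + 3 / 2 * (\<alpha> * g\<^sup>2)"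
        by (simp add: algebra_simps diff_divide_distrib)
      ultimately show ?thesis
        using comb[OF expand[OF less_le_trans[OF \<beta>], of z'] expand[OF \<beta>(1), of z] _ _ 1] by blast
    qed
    ultimately show ?thesis using True by simp
  next
    case False
    have "max (- z / \<beta>) g \<le> 0" using False z \<beta> by simp
    then have le: "z' \<le> z" using z' \<alpha> by (simp add: mult_nonneg_nonpos)
    have "\<beta>' / 2 * (max (g + z' / \<beta>') 0)\<^sup>2 \<le> \<beta> / 2 * (max (g + z / \<beta>) 0)\<^sup>2"
    proof (cases "g + z / \<beta>' \<le> 0")
      case True
      have "z' / \<beta>' \<le> z / \<beta>'" using le \<beta> by (simp add: divide_right_mono)
      then show ?thesis using True \<beta> by simp
    next
      case pos: False
      have zz: "z / \<beta>' \<le> z / \<beta>" using z \<beta> by (intro divide_left_mono) auto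
      have "z' / \<beta>' \<le> z / \<beta>'" using le \<beta> by (simp add: divide_right_mono)
      then have "\<beta>' / 2 * (max (g + z' / \<beta>') 0)\<^sup>2 \<le> \<beta>' / 2 * (g + z / \<beta>')\<^sup>2"
        using pos \<beta> by (intro mult_left_mono power_mono) auto
      also have "\<dots> \<le> \<beta> / 2 * (g + z / \<beta>)\<^sup>2"
      proof -
        have "g\<^sup>2 \<le> (z / \<beta>')\<^sup>2" using pos False by (intro power2_le_iff_abs_le[THEN iffD2]) auto
        also have "\<dots> \<le> z / \<beta> * (z / \<beta>')"
          unfolding power2_eq_square by (intro mult_right_mono zz) (use z \<beta> in auto)
        finally have "(\<beta>' - \<beta>) * (g\<^sup>2 - z / \<beta> * (z / \<beta>')) \<le> 0"
          using \<beta> by (intro mult_nonneg_nonpos) auto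
        moreover have "(\<beta>' - \<beta>) * (g\<^sup>2 - z / \<beta> * (z / \<beta>'))
            = \<beta>' * g\<^sup>2 - \<beta> * g\<^sup>2 - z\<^sup>2 / \<beta> + z\<^sup>2 / \<beta>'"
          using \<beta> by (simp add: power2_eq_square field_simps)
        ultimately have "\<beta>' * g\<^sup>2 - \<beta> * g\<^sup>2 - z\<^sup>2 / \<beta> + z\<^sup>2 / \<beta>' \<le> 0"
          by (simp only:)
        then have "\<beta>' / 2 * g\<^sup>2 + g * z + z\<^sup>2 / \<beta>' / 2 \<le> \<beta> / 2 * g\<^sup>2 + g * z + z\<^sup>2 / \<beta> / 2"
          by simp
        then show ?thesis unfolding expand[OF \<beta>(1)] expand[OF less_le_trans[OF \<beta>]] .
      qed
      also have "\<dots> = \<beta> / 2 * (max (g + z / \<beta>) 0)\<^sup>2" using zz pos by simp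
      finally show ?thesis .
    qed
    then show ?thesis using False by simp
  qed
qed

context weakly_convex_program
begin

section \<open>Multiplier bound from the Slater point, and the change of the smooth part\<close>

lemma norm_g_diff_le:
  assumes "u \<in> X" "w \<in> X"
  shows "norm (g u - g w) \<le> sqrt (real CARD('m)) * B_g * norm (u - w)"
proof (rule power2_le_imp_le)
  have "(norm (g u - g w))\<^sup>2 \<le> (\<Sum>i\<in>(UNIV::'m set). (B_g * norm (u - w))\<^sup>2)"
    unfolding norm_squared_eq_sum
    using g_lip[OF assms] B_g_pos by (intro sum_mono power2_le_iff_abs_le[THEN iffD2]) auto
  then show "(norm (g u - g w))\<^sup>2 \<le> (sqrt (real CARD('m)) * B_g * norm (u - w))\<^sup>2"
    by (simp add: power_mult_distrib)
qed (use B_g_pos in simp)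

lemma multiplier_diff_le:
  assumes "u \<in> X" "w \<in> X" and \<beta>: "\<beta> > 0"
  shows "norm ((eq_multiplier A b \<beta> y u, ineq_multiplier g \<beta> z u)
      - (eq_multiplier A b \<beta> y w, ineq_multiplier g \<beta> z w))
    \<le> \<beta> * norm (u - w) * (spectral_norm A + sqrt (real CARD('m)) * B_g)"
proof -
  have "norm (eq_multiplier A b \<beta> y u - eq_multiplier A b \<beta> y w) = \<beta> * norm (A *v (u - w))"
    using \<beta> by (simp add: eq_multiplier_def matrix_vector_mult_diff_distrib flip: scaleR_diff_right)
  also have "\<dots> \<le> \<beta> * (spectral_norm A * norm (u - w))"
    using \<beta> by (intro mult_left_mono norm_matrix_vector_le_spectral) auto
  finally have 1: "norm (eq_multiplier A b \<beta> y u - eq_multiplier A b \<beta> y w)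
    \<le> \<beta> * (spectral_norm A * norm (u - w))" .
  have "norm (ineq_multiplier g \<beta> z u - ineq_multiplier g \<beta> z w) \<le> norm (\<beta> *\<^sub>R (g u - g w))"
    unfolding ineq_multiplier_def
    by (rule order_trans[OF norm_pos_part_diff_le]) (simp add: scaleR_diff_right)
  also have "\<dots> \<le> \<beta> * (sqrt (real CARD('m)) * B_g * norm (u - w))"
    using \<beta> norm_g_diff_le[OF assms(1,2)] by simp
  finally show ?thesis
    using 1 norm_Pair_le[of "eq_multiplier A b \<beta> y u - eq_multiplier A b \<beta> y w"
        "ineq_multiplier g \<beta> z u - ineq_multiplier g \<beta> z w"]
    by (simp add: algebra_simps)
qed

text \<open>If the multiplier grows, its pairing with the residual at the minimiser is positive; the
  slope inequality, tested at \<open>xfeas\<close> moved against \<open>A\<^sup>T\<close> times the multiplier, then bounds it.\<close>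

lemma multiplier_bound:
  assumes min: "prox_minimizer c \<beta> y z u" and \<beta>: "\<beta> > 0" and c: "c \<in> X"
    and y: "y \<in> range ((*v) A)" and z: "\<And>i. 0 \<le> z $ i"
    and D: "\<And>u w. u \<in> X \<Longrightarrow> w \<in> X \<Longrightarrow> norm (u - w) \<le> D"
    and gmin: "gmin > 0" "\<And>i. gmin \<le> - g xfeas $ i"
    and \<tau>: "\<tau> > 0" "ball xfeas \<tau> \<subseteq> X" "B_g * \<tau> \<le> gmin / 2"
    and \<theta>: "(C + 2 * \<rho> * D) * D \<le> \<theta> * theta_denom A \<tau> gmin"
  shows "norm (eq_multiplier A b \<beta> y u, ineq_multiplier g \<beta> z u) \<le> max (norm (y, z)) \<theta>"
proof (rule ccontr)
  let ?y = "eq_multiplier A b \<beta> y u" and ?z = "ineq_multiplier g \<beta> z u"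
  let ?S = "\<Sum>i\<in>UNIV. ?z $ i"
  assume "\<not> ?thesis"
  then have gt: "norm (y, z) < norm (?y, ?z)" "\<theta> < norm (?y, ?z)" by auto
  have u: "u \<in> X" using min by (simp add: prox_minimizer_def)
  have S: "0 \<le> ?S" by (intro sum_nonneg) simp
  have "(?y, ?z) \<bullet> (y, z) \<le> norm (?y, ?z) * norm (y, z)" by (rule norm_cauchy_schwarz)
  also have "\<dots> < norm (?y, ?z) * norm (?y, ?z)"
    using gt(1) by (intro mult_strict_left_mono) (auto intro: le_less_trans[OF norm_ge_zero])
  also have "\<dots> = (?y, ?z) \<bullet> (?y, ?z)" by (simp add: dot_square_norm power2_eq_square)
  finally have "0 < ?y \<bullet> (?y - y) + ?z \<bullet> (?z - z)" by (simp add: inner_diff_right)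
  moreover have "?y \<bullet> (?y - y) = \<beta> * (?y \<bullet> (A *v u - b))"
    by (subst (2) eq_multiplier_def) simp
  \<comment> \<open>In each coordinate either \<open>?z\<close> vanishes or its increment is \<beta>
    times \<open>g u\<close>.\<close>
  moreover have "?z \<bullet> (?z - z) = \<beta> * (?z \<bullet> g u)"
    unfolding inner_vec_def sum_distrib_left
    by (intro sum.cong) (auto simp: ineq_multiplier_def max_def algebra_simps)
  ultimately have "0 < \<beta> * (?y \<bullet> (A *v u - b) + ?z \<bullet> g u)" by (simp add: algebra_simps)
  then have pos: "0 < ?y \<bullet> (A *v u - b) + ?z \<bullet> g u" using \<beta> by (simp add: zero_less_mult_iff)
  define a where "a = transpose A *v ?y"
  \<comment> \<open>For \<open>a = 0\<close> the choice \<open>n = 0\<close> leaves the Slater point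
    unshifted and keeps \<open>a \<bullet> n = norm a\<close>.\<close>
  define n where "n = (if a = 0 then 0 else a /\<^sub>R norm a)"
  have n: "norm n \<le> 1" "a \<bullet> n = norm a"
    by (auto simp: n_def dot_square_norm power2_eq_square)
  \<comment> \<open>The factor \<open>s < 1\<close> keeps the test point in the open ball, hence in
    the interior; it is removed afterwards by letting \<open>s\<close> tend to 1.\<close>
  have "s * (\<tau> * norm a) \<le> (C + 2 * \<rho> * D) * D - gmin / 2 * ?S" if s: "0 < s" "s < 1" for s
  proof -
    define w where "w = xfeas - (s * \<tau>) *\<^sub>R n"
    have "norm ((s * \<tau>) *\<^sub>R n) \<le> s * \<tau>"
      using n(1) s \<tau> by (simp add: mult_left_le)
    also have "s * \<tau> < \<tau>" using s \<tau> by simp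
    finally have "w \<in> ball xfeas \<tau>" by (simp add: w_def dist_norm)
    then have w: "w \<in> interior X" using \<tau>(2) interior_maximal by blast
    then have wX: "w \<in> X" using interior_subset by blast
    have "(u - c) \<bullet> (w - u) \<le> norm (u - c) * norm (w - u)" by (rule norm_cauchy_schwarz)
    also have "\<dots> \<le> D * D" using D u c wX order_trans[OF norm_ge_zero D[OF u c]]
      by (intro mult_mono) auto
    finally have "2 * \<rho> * ((u - c) \<bullet> (w - u)) \<le> 2 * \<rho> * (D * D)"
      using \<rho>_pos by (intro mult_left_mono) auto
    moreover have "C * norm (w - u) \<le> C * D" using C_nonneg D[OF wX u] by (rule mult_left_mono[rotated])
    ultimately have 1: "0 \<le> (C + 2 * \<rho> * D) * D + lagr_grad \<beta> y z u \<bullet> (w - u)"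
      using prox_minimizer_slope[OF min \<beta> w] by (simp add: inner_add_left algebra_simps)
    have "(\<Sum>i\<in>UNIV. ?z $ i * (jacobian g (at u) *v (w - u)) $ i) \<le> (\<Sum>i\<in>UNIV. ?z $ i * (g w $ i - g u $ i))"
    proof (intro sum_mono mult_left_mono)
      show "(jacobian g (at u) *v (w - u)) $ i \<le> g w $ i - g u $ i" for i
        using g_above_tangent[OF u wX, of i] by linarith
    qed simp
    also have "\<dots> = (\<Sum>i\<in>UNIV. ?z $ i * g w $ i) - ?z \<bullet> g u"
      by (simp add: inner_vec_def right_diff_distrib sum_subtractf)
    also have "(\<Sum>i\<in>UNIV. ?z $ i * g w $ i) \<le> (\<Sum>i\<in>UNIV. ?z $ i * (- (gmin / 2)))"
    proof (intro sum_mono mult_left_mono)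
      fix i
      have "g w $ i - g xfeas $ i \<le> B_g * norm (w - xfeas)"
        using g_lip[OF wX xfeas_in_X, of i] by linarith
      also have "\<dots> \<le> B_g * \<tau>"
        using \<open>w \<in> ball xfeas \<tau>\<close> B_g_pos by (intro mult_left_mono) (auto simp: dist_norm norm_minus_commute)
      finally show "g w $ i \<le> - (gmin / 2)" using \<tau>(3) gmin(2)[of i] by linarith
    qed simp
    finally have 2: "(\<Sum>i\<in>UNIV. ?z $ i * (jacobian g (at u) *v (w - u)) $ i) \<le> - (gmin / 2 * ?S) - ?z \<bullet> g u"
      by (simp add: sum_distrib_left sum_negf mult.commute)
    have "A *v (w - u) = - ((s * \<tau>) *\<^sub>R (A *v n)) - (A *v u - b)"
      by (simp add: w_def matrix_vector_mult_diff_distrib matrix_vector_mult_scaleR xfeas_eq)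
    then have "?y \<bullet> (A *v (w - u)) = - (s * \<tau> * (?y \<bullet> (A *v n))) - ?y \<bullet> (A *v u - b)"
      by (simp add: inner_diff_right)
    also have "?y \<bullet> (A *v n) = norm a"
      using n(2) by (simp only: a_def transpose_matrix_inner)
    finally show ?thesis using 1 2 pos by (simp add: lagr_grad_inner)
  qed
  then have "\<tau> * norm a \<le> (C + 2 * \<rho> * D) * D - gmin / 2 * ?S"
    by (rule field_le_mult_one_interval)
  then have R: "\<tau> * norm a + gmin / 2 * ?S \<le> \<theta> * theta_denom A \<tau> gmin" using \<theta> by linarith
  \<comment> \<open>The eigenvalue bound holds on the range of \<open>A\<close> only;
    \<open>b = A *v xfeas\<close> keeps the update inside it.\<close>
  have yA: "?y \<in> range ((*v) A)"
  proof -
    obtain s where "y = A *v s" using y by auto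
    then have "?y = A *v (s + \<beta> *\<^sub>R (u - xfeas))"
      by (simp add: eq_multiplier_def matrix_vector_right_distrib matrix_vector_mult_scaleR
          matrix_vector_mult_diff_distrib xfeas_eq)
    then show ?thesis by blast
  qed
  have zS: "norm ?z \<le> ?S" using norm_le_l1_cart[of ?z] by simp
  \<comment> \<open>The denominator is the smaller of the two weights once \<open>norm a\<close> is
    bounded below by the eigenvalue. If \<open>A = 0\<close>, the range condition forces
    \<open>?y = 0\<close> and only the weight \<open>gmin / 2\<close> remains.\<close>
  have "theta_denom A \<tau> gmin > 0 \<and> theta_denom A \<tau> gmin * norm (?y, ?z) \<le> \<tau> * norm a + gmin / 2 * ?S"
  proof (cases "A = 0")
    case True
    then have "?y = 0" using yA by auto
    then have "norm (?y, ?z) \<le> ?S" using zS by (simp add: norm_Pair)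
    then show ?thesis using True gmin(1) \<tau>(1) by (simp add: theta_denom_def add_increasing)
  next
    case False
    let ?l = "sqrt (lambda_min_pos (A ** transpose A))"
    let ?d = "theta_denom A \<tau> gmin"
    have d: "?d = min (\<tau> * ?l) (gmin / 2)" using False by (simp add: theta_denom_def)
    have l: "?l > 0" using lambda_min_pos_gt_0[OF False] by simp
    have d0: "?d > 0" using d l gmin(1) \<tau>(1) by (simp add: min_def)
    have "?d * norm (?y, ?z) \<le> ?d * (norm ?y + norm ?z)"
      using d0 by (intro mult_left_mono norm_Pair_le) auto
    also have "\<dots> = ?d * norm ?y + ?d * norm ?z" by (simp add: algebra_simps)
    also have "\<dots> \<le> (\<tau> * ?l) * norm ?y + gmin / 2 * ?S"
      using d d0 zS S by (intro add_mono mult_mono) auto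
    also have "(\<tau> * ?l) * norm ?y \<le> \<tau> * norm a"
      using lambda_min_pos_le[OF False yA] \<tau>(1) by (simp add: a_def mult.assoc del: transpose_matrix_vector)
    finally show ?thesis using d0 by simp
  qed
  then have d: "theta_denom A \<tau> gmin > 0"
    and le: "theta_denom A \<tau> gmin * norm (?y, ?z) \<le> \<tau> * norm a + gmin / 2 * ?S"
    by blast+
  have "theta_denom A \<tau> gmin * norm (?y, ?z) \<le> theta_denom A \<tau> gmin * \<theta>"
    using order_trans[OF le R] by (simp only: mult.commute[of \<theta>])
  then have "norm (?y, ?z) \<le> \<theta>" using d by (rule mult_left_le_imp_le)
  then show False using gt(2) by simp
qed

text \<open>Adding \<open>(norm z)\<^sup>2 / (2 * \<beta>)\<close> cancels the last term of
  \<open>smooth_part\<close>. What is left splits into the equality part and one scalar penalty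
  comparison per inequality constraint, whose errors recombine to the squared violation.\<close>

lemma smooth_part_update_le:
  assumes z: "\<And>i. 0 \<le> z $ i" and \<alpha>: "0 \<le> \<alpha>" "\<alpha> \<le> \<beta>" and \<beta>: "0 < \<beta>" "\<beta> \<le> \<beta>'"
    and y': "y' = y + \<alpha> *\<^sub>R (A *v u - b)"
    and z': "z' = z + \<alpha> *\<^sub>R (\<chi> i. max (- (z $ i) / \<beta>) (g u $ i))"
  defines "w \<equiv> constraint_violation A b g u"
  shows "smooth_part \<beta>' y' z' u + (norm z')\<^sup>2 / (2 * \<beta>')
    \<le> smooth_part \<beta> y z u + (norm z)\<^sup>2 / (2 * \<beta>)
      + ((\<beta>' - \<beta>) / 2 + 3 / 2 * \<alpha>) * w\<^sup>2 + \<alpha> / \<beta> * (norm z * w)"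
proof -
  let ?r = "norm (A *v u - b)" and ?p = "pos_part (g u)" and ?K = "(\<beta>' - \<beta>) / 2 + 3 / 2 * \<alpha>"
  have p: "(norm ?p)\<^sup>2 = (\<Sum>i\<in>UNIV. (max (g u $ i) 0)\<^sup>2)"
    by (simp add: norm_squared_eq_sum)
  have zp: "z \<bullet> ?p = (\<Sum>i\<in>UNIV. z $ i * max (g u $ i) 0)" by (simp add: inner_vec_def)
  have "\<beta>' / 2 * (norm (pos_part (g u + z' /\<^sub>R \<beta>')))\<^sup>2 \<le> \<beta> / 2 * (norm (pos_part (g u + z /\<^sub>R \<beta>)))\<^sup>2
      + ?K * (norm ?p)\<^sup>2 + \<alpha> / \<beta> * (z \<bullet> ?p)"
    unfolding p zp norm_pos_part_squared_eq_sum sum_distrib_left sum.distrib[symmetric]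
  proof (rule sum_mono)
    fix i
    show "\<beta>' / 2 * (max (g u $ i + z' $ i / \<beta>') 0)\<^sup>2 \<le> \<beta> / 2 * (max (g u $ i + z $ i / \<beta>) 0)\<^sup>2
      + ?K * (max (g u $ i) 0)\<^sup>2 + \<alpha> / \<beta> * (z $ i * max (g u $ i) 0)"
      by (rule pos_part_penalty_update_le[OF z \<alpha> \<beta>]) (simp add: z')
  qed
  moreover have "z \<bullet> ?p \<le> norm z * w"
  proof -
    have "norm ?p \<le> w"
      unfolding w_def constraint_violation_def by (simp add: real_le_rsqrt)
    then show ?thesis
      using norm_cauchy_schwarz[of z ?p] mult_left_mono[of "norm ?p" w "norm z"] by auto
  qed
  then have "\<alpha> / \<beta> * (z \<bullet> ?p) \<le> \<alpha> / \<beta> * (norm z * w)"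
    using \<alpha> \<beta> by (intro mult_left_mono) auto
  moreover have "y' \<bullet> (A *v u - b) + \<beta>' / 2 * ?r\<^sup>2 \<le> y \<bullet> (A *v u - b) + \<beta> / 2 * ?r\<^sup>2 + ?K * ?r\<^sup>2"
  proof -
    have "y' \<bullet> (A *v u - b) = y \<bullet> (A *v u - b) + \<alpha> * ?r\<^sup>2"
      by (simp add: y' inner_add_left dot_square_norm)
    moreover have "0 \<le> \<alpha> * ?r\<^sup>2" using \<alpha> by simp
    moreover have "?K * ?r\<^sup>2 = \<beta>' / 2 * ?r\<^sup>2 - \<beta> / 2 * ?r\<^sup>2 + 3 / 2 * (\<alpha> * ?r\<^sup>2)"
      by (simp add: algebra_simps diff_divide_distrib)
    ultimately show ?thesis by linarith
  qed
  moreover have "?K * w\<^sup>2 = ?K * ?r\<^sup>2 + ?K * (norm ?p)\<^sup>2"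
    by (simp add: w_def constraint_violation_squared distrib_left)
  ultimately show ?thesis unfolding smooth_part_def by linarith
qed

end

section \<open>Iterates of the damped method\<close>

text \<open>Only inequalities between the parameter sequences enter. \<open>u_multiplier\<close> is
  conditional, as its premises are invariants established below; \<open>Bp_bound\<close> is phrased
  with partial sums, so convergence is settled where the locale is instantiated. The constant
  \<open>c\<close> bounds the multiplier change of a full step at the inexact iterate.\<close>

locale dpalm = weakly_convex_program \<phi> X A b g \<rho> C B_g xfeas
  for \<phi> :: "real^'d \<Rightarrow> real" and X and A :: "real^'d^'n" and b :: "real^'n"
    and g :: "real^'d \<Rightarrow> real^'m" and \<rho> C B_g :: real and xfeas :: "real^'d" +
  fixes x u :: "nat \<Rightarrow> real^'d" and y :: "nat \<Rightarrow> real^'n" and z :: "nat \<Rightarrow> real^'m"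
    and \<alpha> \<beta> v \<delta> :: "nat \<Rightarrow> real" and M \<theta> Bp c :: real
  assumes M_eq: "M = spectral_norm A + sqrt (real CARD('m)) * B_g"
    and \<beta>_pos: "\<And>k. 0 < \<beta> k" and \<beta>_mono: "\<And>k. \<beta> k \<le> \<beta> (Suc k)"
    and \<beta>_ratio: "\<And>k. \<beta> (Suc k) \<le> 3 / 2 * \<beta> k"
    and \<alpha>_nonneg: "\<And>k. 0 \<le> \<alpha> k" and \<alpha>_le: "\<And>k. \<alpha> k \<le> \<beta> k"
    and \<alpha>_violation: "\<And>k. \<alpha> k * constraint_violation A b g (x (Suc k)) \<le> v k"
    and x_in: "\<And>k. x k \<in> X"
    and y_init: "y 0 \<in> range ((*v) A)" and z_init: "\<And>i. 0 \<le> z 0 $ i"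
    and y_step: "\<And>k. y (Suc k) = y k + \<alpha> k *\<^sub>R (A *v x (Suc k) - b)"
    and z_step: "\<And>k. z (Suc k) =
          z k + \<alpha> k *\<^sub>R (\<chi> i. max (- (z k $ i) / \<beta> k) (g (x (Suc k)) $ i))"
    and u_min: "\<And>k. prox_minimizer (x k) (\<beta> k) (y k) (z k) (u k)"
    and x_near: "\<And>k. norm (x (Suc k) - u k) \<le> \<delta> k"
    and u_multiplier: "\<And>k. y k \<in> range ((*v) A) \<Longrightarrow> (\<And>i. 0 \<le> z k $ i) \<Longrightarrow>
      norm (eq_multiplier A b (\<beta> k) (y k) (u k), ineq_multiplier g (\<beta> k) (z k) (u k))
        \<le> max (norm (y k, z k)) \<theta>"
    and Bp_bound: "\<And>k. max (norm (y 0, z 0)) \<theta> + (\<Sum>j<k. \<alpha> j * \<delta> j * M) \<le> Bp"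
    and c_bound: "\<And>k. 2 * Bp + \<beta> k * \<delta> k * M \<le> c"
begin

abbreviation "viol \<equiv> constraint_violation A b g"
abbreviation "multipliers k w \<equiv> (eq_multiplier A b (\<beta> k) (y k) w, ineq_multiplier g (\<beta> k) (z k) w)"

section \<open>Boundedness of the multipliers and decay of infeasibility\<close>

lemma u_in: "u k \<in> X"
  using u_min by (simp add: prox_minimizer_def)

lemma z_step_eq: "z (Suc k) = (1 - \<alpha> k / \<beta> k) *\<^sub>R z k + (\<alpha> k / \<beta> k) *\<^sub>R ineq_multiplier g (\<beta> k) (z k) (x (Suc k))"
proof -
  have "max (- (z k $ i) / \<beta> k) (g (x (Suc k)) $ i)
      = (ineq_multiplier g (\<beta> k) (z k) (x (Suc k)) $ i - z k $ i) / \<beta> k" for i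
    using \<beta>_pos[of k] by (simp add: ineq_multiplier_def max_def field_simps)
  then show ?thesis
    unfolding z_step vec_eq_iff vector_add_component vector_scaleR_component vec_lambda_beta
    by (simp only:) (simp add: algebra_simps diff_divide_distrib)
qed

lemma y_step_eq: "y (Suc k) = (1 - \<alpha> k / \<beta> k) *\<^sub>R y k + (\<alpha> k / \<beta> k) *\<^sub>R eq_multiplier A b (\<beta> k) (y k) (x (Suc k))"
  using \<beta>_pos[of k] by (simp add: y_step eq_multiplier_def algebra_simps)

lemma step_ratio: "0 \<le> \<alpha> k / \<beta> k" "\<alpha> k / \<beta> k \<le> 1"
  using \<alpha>_nonneg[of k] \<alpha>_le[of k] \<beta>_pos[of k] by auto

lemma y_range: "y k \<in> range ((*v) A)"
proof (induction k)
  case (Suc k)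
  then obtain s where "y k = A *v s" by auto
  then have "y (Suc k) = A *v (s + \<alpha> k *\<^sub>R (x (Suc k) - xfeas))"
    by (simp add: y_step matrix_vector_right_distrib matrix_vector_mult_scaleR
        matrix_vector_mult_diff_distrib xfeas_eq)
  then show ?case by blast
qed (rule y_init)

lemma z_nonneg: "0 \<le> z k $ i"
proof (induction k)
  case (Suc k)
  then show ?case
    unfolding z_step_eq vector_add_component vector_scaleR_component real_scaleR_def
    using step_ratio[of k] by (intro add_nonneg_nonneg mult_nonneg_nonneg) auto
qed (rule z_init)

lemma mult_x_near: "norm (multipliers k (x (Suc k)) - multipliers k (u k)) \<le> \<beta> k * \<delta> k * M"
proof -
  have M: "0 \<le> M" using spectral_norm_nonneg[of A] B_g_pos by (simp add: M_eq)
  have "norm (multipliers k (x (Suc k)) - multipliers k (u k)) \<le> \<beta> k * norm (x (Suc k) - u k) * M"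
    unfolding M_eq by (rule multiplier_diff_le[OF x_in u_in \<beta>_pos])
  also have "\<dots> \<le> \<beta> k * \<delta> k * M"
    using x_near[of k] \<beta>_pos[of k] M by (intro mult_right_mono mult_left_mono) auto
  finally show ?thesis .
qed

text \<open>A full step from the exact minimiser respects the bound reached so far; replacing it by
  \<open>x (Suc k)\<close> costs \<open>\<beta> k * \<delta> k * M\<close>, and the damping weight
  \<open>\<alpha> k / \<beta> k\<close> turns this into the summand
  \<open>\<alpha> k * \<delta> k * M\<close> of \<open>Bp\<close>.\<close>

lemma dual_bound_partial: "norm (y k, z k) \<le> max (norm (y 0, z 0)) \<theta> + (\<Sum>j<k. \<alpha> j * \<delta> j * M)"
proof (induction k)
  case (Suc k)
  let ?s = "\<alpha> k / \<beta> k" and ?B = "max (norm (y 0, z 0)) \<theta> + (\<Sum>j<k. \<alpha> j * \<delta> j * M)"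
  have "\<theta> \<le> max (norm (y 0, z 0)) \<theta>" by simp
  have nn: "0 \<le> (\<Sum>j<k. \<alpha> j * \<delta> j * M)"
  proof (intro sum_nonneg mult_nonneg_nonneg)
    show "0 \<le> \<delta> j" for j using x_near[of j] norm_ge_zero order_trans by blast
    show "0 \<le> M" using spectral_norm_nonneg[of A] B_g_pos by (simp add: M_eq)
  qed (rule \<alpha>_nonneg)
  have "norm (multipliers k (u k)) \<le> ?B"
    using u_multiplier[OF y_range z_nonneg, of k] Suc nn by linarith
  then have m: "norm (multipliers k (x (Suc k))) \<le> ?B + \<beta> k * \<delta> k * M"
    using norm_triangle_ineq[of "multipliers k (u k)" "multipliers k (x (Suc k)) - multipliers k (u k)"] mult_x_near[of k]
    by simp
  have "(y (Suc k), z (Suc k)) = (1 - ?s) *\<^sub>R (y k, z k) + ?s *\<^sub>R multipliers k (x (Suc k))"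
    by (simp add: y_step_eq z_step_eq)
  then have "norm (y (Suc k), z (Suc k)) \<le> norm ((1 - ?s) *\<^sub>R (y k, z k)) + norm (?s *\<^sub>R multipliers k (x (Suc k)))"
    by (simp only: norm_triangle_ineq)
  also have "\<dots> = (1 - ?s) * norm (y k, z k) + ?s * norm (multipliers k (x (Suc k)))"
    using step_ratio[of k] by (simp only: norm_scaleR abs_of_nonneg diff_ge_0_iff_ge)
  also have "\<dots> \<le> (1 - ?s) * ?B + ?s * (?B + \<beta> k * \<delta> k * M)"
    using step_ratio[of k] by (intro add_mono mult_left_mono Suc m) auto
  also have "\<dots> = ?B + \<alpha> k * \<delta> k * M"
    using \<beta>_pos[of k] by (simp add: field_simps)
  finally show ?case by simp
qed simp

lemma dual_bound: "norm (y k, z k) \<le> Bp"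
  using dual_bound_partial[of k] Bp_bound[of k] by linarith

lemma \<theta>_le_Bp: "\<theta> \<le> Bp"
  using Bp_bound[of 0] by simp

lemma mult_bound: "norm (multipliers k (u k)) \<le> Bp"
  using u_multiplier[OF y_range z_nonneg, of k] dual_bound[of k] \<theta>_le_Bp by linarith

lemma Bp_nonneg: "0 \<le> Bp"
  using dual_bound[of 0] norm_ge_zero order_trans by blast

lemma norm_y_le: "norm (y k) \<le> Bp" and norm_z_le: "norm (z k) \<le> Bp"
  by (rule order_trans[OF norm_fst_le dual_bound], rule order_trans[OF norm_snd_le dual_bound])

lemma mult_change_bound: "norm (multipliers k (u k) - (y k, z k)) \<le> 2 * Bp"
  using norm_triangle_ineq4[of "multipliers k (u k)" "(y k, z k)"] mult_bound[of k] dual_bound[of k]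
  by linarith

lemma violation_u_le: "viol (u k) \<le> 2 * Bp / \<beta> k"
proof -
  have "\<beta> k * viol (u k) \<le> 2 * Bp"
    using constraint_violation_le_multiplier_change[where \<beta> = "\<beta> k" and z = "z k" and A = A and b = b
        and g = g and u = "u k" and y = "y k", OF \<beta>_pos z_nonneg]
      mult_change_bound[of k] by simp
  then show ?thesis using \<beta>_pos[of k] by (simp add: field_simps)
qed

lemma violation_x_le: "viol (x (Suc k)) \<le> c / \<beta> k"
proof -
  have "norm (multipliers k (x (Suc k)) - (y k, z k)) \<le> c"
    using dist_triangle[of "multipliers k (x (Suc k))" "(y k, z k)" "multipliers k (u k)"]
      mult_x_near[of k] mult_change_bound[of k] c_bound[of k] unfolding dist_norm by linarith
  then have "\<beta> k * viol (x (Suc k)) \<le> c"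
    using constraint_violation_le_multiplier_change[where \<beta> = "\<beta> k" and z = "z k" and A = A and b = b
        and g = g and u = "x (Suc k)" and y = "y k", OF \<beta>_pos z_nonneg]
    by simp
  then show ?thesis using \<beta>_pos[of k] by (simp add: field_simps)
qed

lemma complementarity_u_le:
  "(\<Sum>i\<in>UNIV. \<bar>ineq_multiplier g (\<beta> k) (z k) (u k) $ i * g (u k) $ i\<bar>) \<le> 2 * Bp\<^sup>2 / \<beta> k"
proof -
  let ?z = "ineq_multiplier g (\<beta> k) (z k) (u k)"
  have "norm ?z \<le> Bp" by (rule order_trans[OF norm_snd_le mult_bound])
  moreover have "norm (?z - z k) \<le> 2 * Bp"
    by (rule order_trans[OF norm_snd_le mult_change_bound[of k, unfolded diff_Pair]])
  ultimately have "norm ?z * norm (?z - z k) \<le> Bp * (2 * Bp)"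
    by (intro mult_mono Bp_nonneg) auto
  then have "\<beta> k * (\<Sum>i\<in>UNIV. \<bar>?z $ i * g (u k) $ i\<bar>) \<le> 2 * Bp\<^sup>2"
    using ineq_multiplier_complementarity[where \<beta> = "\<beta> k" and z = "z k" and g = g and u = "u k",
        OF \<beta>_pos z_nonneg]
    by (simp add: power2_eq_square)
  then show ?thesis using \<beta>_pos[of k] by (simp add: field_simps)
qed

text \<open>The augmented Lagrangian at \<open>x k\<close> plus the \<open>z\<close>-term whose increments telescope.\<close>

definition pot :: "nat \<Rightarrow> real" where
  "pot k = lagr (\<beta> k) (y k) (z k) (x k) + (norm (z k))\<^sup>2 / (2 * \<beta> k)"

lemma c_nonneg: "0 \<le> c"
proof -
  have "0 \<le> norm (multipliers 0 (x (Suc 0)) - multipliers 0 (u 0))" by simp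
  then have "0 \<le> \<beta> 0 * \<delta> 0 * M" using mult_x_near[of 0] order_trans by blast
  then show ?thesis using c_bound[of 0] Bp_nonneg by linarith
qed

lemma v_nonneg: "0 \<le> v k"
  by (rule order_trans[OF mult_nonneg_nonneg[OF \<alpha>_nonneg constraint_violation_nonneg] \<alpha>_violation])

text \<open>With violation at most \<open>c / \<beta> k\<close>, the increased penalty costs
  \<open>c\<^sup>2 * (\<beta> (Suc k) - \<beta> k) / (2 * (\<beta> k)\<^sup>2)\<close>; the growth
  ratio 3/2 replaces one factor \<open>\<beta> k\<close> by \<open>\<beta> (Suc k)\<close> and gives
  the telescoping term with 3/4. In the multiplier terms one factor of the violation is absorbed by
  damping into \<open>v k\<close>.\<close>

lemma lagr_diff_le:
  "lagr (\<beta> k) (y k) (z k) (x k) - lagr (\<beta> k) (y k) (z k) (x (Suc k))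
    \<le> pot k - pot (Suc k) + 3 / 4 * c\<^sup>2 * (1 / \<beta> k - 1 / \<beta> (Suc k)) + (3 / 2 * c + Bp) * (v k / \<beta> k)"
proof -
  let ?w = "viol (x (Suc k))" and ?\<beta>' = "\<beta> (Suc k)"
  have w0: "0 \<le> ?w" by (rule constraint_violation_nonneg)
  have \<beta>: "0 < \<beta> k" "0 < ?\<beta>'" "\<beta> k \<le> ?\<beta>'" "?\<beta>' \<le> 3 / 2 * \<beta> k"
    using \<beta>_pos \<beta>_mono \<beta>_ratio by auto
  have "smooth_part ?\<beta>' (y (Suc k)) (z (Suc k)) (x (Suc k)) + (norm (z (Suc k)))\<^sup>2 / (2 * ?\<beta>')
    \<le> smooth_part (\<beta> k) (y k) (z k) (x (Suc k)) + (norm (z k))\<^sup>2 / (2 * \<beta> k)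
      + ((?\<beta>' - \<beta> k) / 2 + 3 / 2 * \<alpha> k) * ?w\<^sup>2 + \<alpha> k / \<beta> k * (norm (z k) * ?w)"
    by (rule smooth_part_update_le[OF z_nonneg \<alpha>_nonneg \<alpha>_le \<beta>(1,3) y_step z_step])
  then have "lagr (\<beta> k) (y k) (z k) (x k) - lagr (\<beta> k) (y k) (z k) (x (Suc k)) \<le> pot k - pot (Suc k)
      + ((?\<beta>' - \<beta> k) / 2 + 3 / 2 * \<alpha> k) * ?w\<^sup>2 + \<alpha> k / \<beta> k * (norm (z k) * ?w)"
    by (simp add: pot_def lagr_def)
  moreover have "(?\<beta>' - \<beta> k) / 2 * ?w\<^sup>2 \<le> 3 / 4 * c\<^sup>2 * (1 / \<beta> k - 1 / ?\<beta>')"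
  proof -
    have "(?\<beta>' - \<beta> k) / 2 * ?w\<^sup>2 \<le> (?\<beta>' - \<beta> k) / 2 * (c / \<beta> k)\<^sup>2"
      using \<beta> w0 violation_x_le[of k] by (intro mult_left_mono power_mono) auto
    also have "\<dots> = c\<^sup>2 * (?\<beta>' - \<beta> k) / (2 * (\<beta> k * \<beta> k))"
      by (simp add: power_divide power2_eq_square)
    also have "\<dots> \<le> c\<^sup>2 * (?\<beta>' - \<beta> k) / (4 / 3 * (\<beta> k * ?\<beta>'))"
    proof (rule divide_left_mono)
      have "\<beta> k * ?\<beta>' \<le> \<beta> k * (3 / 2 * \<beta> k)" using \<beta> by (intro mult_left_mono) auto
      then show "4 / 3 * (\<beta> k * ?\<beta>') \<le> 2 * (\<beta> k * \<beta> k)" by simp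
    qed (use \<beta> in auto)
    also have "\<dots> = 3 / 4 * c\<^sup>2 * (1 / \<beta> k - 1 / ?\<beta>')"
      using \<beta> by (simp add: field_simps)
    finally show ?thesis .
  qed
  moreover have "\<alpha> k * ?w\<^sup>2 \<le> c * (v k / \<beta> k)"
  proof -
    have "\<alpha> k * ?w * ?w \<le> v k * (c / \<beta> k)"
      using \<alpha>_violation[of k] violation_x_le[of k] w0 v_nonneg[of k] by (intro mult_mono) auto
    then show ?thesis by (simp add: power2_eq_square mult_ac)
  qed
  moreover have "\<alpha> k / \<beta> k * (norm (z k) * ?w) \<le> Bp * (v k / \<beta> k)"
  proof -
    have "norm (z k) * (\<alpha> k * ?w) \<le> Bp * v k"
      using \<alpha>_violation[of k] norm_z_le[of k] Bp_nonneg w0 \<alpha>_nonneg[of k] by (intro mult_mono) auto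
    then show ?thesis using \<beta> by (simp add: field_simps)
  qed
  moreover have "((?\<beta>' - \<beta> k) / 2 + 3 / 2 * \<alpha> k) * ?w\<^sup>2 = (?\<beta>' - \<beta> k) / 2 * ?w\<^sup>2 + 3 / 2 * (\<alpha> k * ?w\<^sup>2)"
    "(3 / 2 * c + Bp) * (v k / \<beta> k) = 3 / 2 * (c * (v k / \<beta> k)) + Bp * (v k / \<beta> k)"
    by (simp_all only: distrib_right mult.assoc)
  ultimately show ?thesis by linarith
qed

section \<open>Telescoping and two-sided bounds for the potential\<close>

lemma sum_lagr_diff_le:
  "(\<Sum>k<n. lagr (\<beta> (a + k)) (y (a + k)) (z (a + k)) (x (a + k))
      - lagr (\<beta> (a + k)) (y (a + k)) (z (a + k)) (x (Suc (a + k))))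
    \<le> pot a - pot (a + n) + 3 / 4 * c\<^sup>2 * (1 / \<beta> a - 1 / \<beta> (a + n))
      + (3 / 2 * c + Bp) * (\<Sum>k<n. v (a + k) / \<beta> (a + k))"
proof (induction n)
  case (Suc n)
  have "3 / 4 * c\<^sup>2 * (1 / \<beta> a - 1 / \<beta> (a + Suc n)) = 3 / 4 * c\<^sup>2 * (1 / \<beta> a - 1 / \<beta> (a + n))
      + 3 / 4 * c\<^sup>2 * (1 / \<beta> (a + n) - 1 / \<beta> (Suc (a + n)))"
    by (simp only: right_diff_distrib add_Suc_right)
  moreover have "(3 / 2 * c + Bp) * (\<Sum>k<Suc n. v (a + k) / \<beta> (a + k))
      = (3 / 2 * c + Bp) * (\<Sum>k<n. v (a + k) / \<beta> (a + k)) + (3 / 2 * c + Bp) * (v (a + n) / \<beta> (a + n))"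
    by (simp only: sum.lessThan_Suc distrib_left)
  ultimately show ?case
    using Suc lagr_diff_le[of "a + n"] by (simp only: sum.lessThan_Suc add_Suc_right)
qed simp

text \<open>\<open>pot (Suc k)\<close> weighs the violation of \<open>x (Suc k)\<close> with the
  next penalty, so the bound is restated for it; the loss is the growth ratio.\<close>

lemma violation_x_le_same: "viol (x (Suc k)) \<le> 3 / 2 * c / \<beta> (Suc k)"
proof -
  have "c / \<beta> k \<le> 3 / 2 * c / \<beta> (Suc k)"
    using \<beta>_pos[of k] \<beta>_pos[of "Suc k"] \<beta>_ratio[of k] mult_left_mono[OF \<beta>_ratio[of k] c_nonneg]
    by (simp add: field_simps)
  then show ?thesis using violation_x_le[of k] by linarith
qed

lemma pairing_le: "\<bar>y (Suc k) \<bullet> (A *v x (Suc k) - b)\<bar> \<le> 3 / 2 * (c * Bp) / \<beta> (Suc k)"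
proof -
  have "norm (A *v x (Suc k) - b) \<le> viol (x (Suc k))"
    by (simp add: constraint_violation_eq norm_fst_le)
  then have "norm (y (Suc k)) * norm (A *v x (Suc k) - b) \<le> Bp * (3 / 2 * c / \<beta> (Suc k))"
    using norm_y_le violation_x_le_same[of k] Bp_nonneg by (intro mult_mono) auto
  then show ?thesis
    using Cauchy_Schwarz_ineq2[of "y (Suc k)" "A *v x (Suc k) - b"] by (simp add: mult_ac)
qed

text \<open>After cancellation of the \<open>z\<close>-term, only the pairing of \<open>y\<close>
  with the residual can be negative.\<close>

lemma pot_lower: "\<phi> (x (Suc k)) - 3 / 2 * (c * Bp) / \<beta> (Suc k) \<le> pot (Suc k)"
proof -
  have "0 \<le> \<beta> (Suc k) / 2 * (norm (A *v x (Suc k) - b))\<^sup>2"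
    "0 \<le> \<beta> (Suc k) / 2 * (norm (pos_part (g (x (Suc k)) + z (Suc k) /\<^sub>R \<beta> (Suc k))))\<^sup>2"
    using \<beta>_pos[of "Suc k"] by auto
  then show ?thesis
    using pairing_le[of k] unfolding pot_def lagr_def smooth_part_def by linarith
qed

text \<open>The shift by \<open>z / \<beta>\<close> moves the positive part by at most
  \<open>Bp / \<beta>\<close>, so the penalties are at most \<open>\<beta> / 2\<close> times the
  square of \<open>(3 / 2 * c + Bp) / \<beta>\<close>. This gives half of the mixed term; the
  pairing with \<open>y\<close> gives the other half.\<close>

lemma pot_upper:
  "pot (Suc k) \<le> \<phi> (x (Suc k)) + (9 / 8 * c\<^sup>2 + 3 * (c * Bp) + Bp\<^sup>2 / 2) / \<beta> (Suc k)"
proof -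
  let ?\<beta> = "\<beta> (Suc k)" and ?x = "x (Suc k)" and ?z = "z (Suc k)"
  let ?w = "viol ?x" and ?r = "norm (A *v ?x - b)" and ?p = "norm (pos_part (g ?x))"
  let ?q = "norm (pos_part (g ?x + ?z /\<^sub>R ?\<beta>))" and ?s = "Bp / ?\<beta>"
  have \<beta>: "0 < ?\<beta>" by (rule \<beta>_pos)
  have "?q \<le> norm (pos_part (g ?x)) + norm (pos_part (g ?x + ?z /\<^sub>R ?\<beta>) - pos_part (g ?x))"
    using norm_triangle_ineq[of "pos_part (g ?x)" "pos_part (g ?x + ?z /\<^sub>R ?\<beta>) - pos_part (g ?x)"]
    by simp
  also have "\<dots> \<le> ?p + norm ((g ?x + ?z /\<^sub>R ?\<beta>) - g ?x)"
    using norm_pos_part_diff_le by (intro add_left_mono)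
  also have "\<dots> \<le> ?p + ?s"
    using norm_z_le[of "Suc k"] \<beta> by (simp add: field_simps)
  finally have "?q\<^sup>2 \<le> (?p + ?s)\<^sup>2" by (intro power_mono) auto
  also have "\<dots> = ?p\<^sup>2 + 2 * ?p * ?s + ?s\<^sup>2" by (simp add: power2_sum)
  also have "\<dots> \<le> ?p\<^sup>2 + 2 * ?w * ?s + ?s\<^sup>2"
    using Bp_nonneg \<beta> norm_snd_le[of "pos_part (g ?x)" "A *v ?x - b"]
    by (intro add_mono mult_right_mono mult_left_mono) (auto simp: constraint_violation_eq)
  finally have "?r\<^sup>2 + ?q\<^sup>2 \<le> ?w\<^sup>2 + 2 * ?w * ?s + ?s\<^sup>2"
    by (simp add: constraint_violation_squared)
  also have "\<dots> = (?w + ?s)\<^sup>2" by (simp add: power2_sum)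
  also have "\<dots> \<le> (3 / 2 * c / ?\<beta> + ?s)\<^sup>2"
    using violation_x_le_same[of k] Bp_nonneg \<beta> constraint_violation_nonneg[of A b g ?x]
    by (intro power_mono add_right_mono) auto
  also have "\<dots> = (3 / 2 * c + Bp)\<^sup>2 / ?\<beta>\<^sup>2"
    by (simp add: add_divide_distrib flip: power_divide)
  finally have "?\<beta> / 2 * (?r\<^sup>2 + ?q\<^sup>2) \<le> ?\<beta> / 2 * ((3 / 2 * c + Bp)\<^sup>2 / ?\<beta>\<^sup>2)"
    using \<beta> by (intro mult_left_mono) auto
  also have "\<dots> = (9 / 8 * c\<^sup>2 + 3 / 2 * (c * Bp) + Bp\<^sup>2 / 2) / ?\<beta>"
    using \<beta> by (simp add: power2_eq_square field_simps)
  finally have "?\<beta> / 2 * ?r\<^sup>2 + ?\<beta> / 2 * ?q\<^sup>2 \<le> (9 / 8 * c\<^sup>2 + 3 / 2 * (c * Bp) + Bp\<^sup>2 / 2) / ?\<beta>"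
    by (simp only: distrib_left)
  moreover have "(9 / 8 * c\<^sup>2 + 3 * (c * Bp) + Bp\<^sup>2 / 2) / ?\<beta>
      = (9 / 8 * c\<^sup>2 + 3 / 2 * (c * Bp) + Bp\<^sup>2 / 2) / ?\<beta> + 3 / 2 * (c * Bp) / ?\<beta>"
    unfolding add_divide_distrib[symmetric] by simp
  ultimately show ?thesis
    using pairing_le[of k] unfolding pot_def lagr_def smooth_part_def by linarith
qed

text \<open>The start \<open>a\<close> must be at least 1 because the potential is bounded only at
  indices that follow a step. With \<open>Bp \<le> c / 4\<close> all terms over \<beta> fit under
  7/2, the value of 14/4 in \<open>Cx\<close>.\<close>

lemma sum_lagr_diff_le_constant:
  assumes F: "\<And>w. w \<in> X \<Longrightarrow> \<bar>\<phi> w\<bar> \<le> Fmax" and c: "4 * Bp \<le> c" and a: "1 \<le> a"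
    and v: "\<And>n. (\<Sum>k<n. v (a + k) / \<beta> (a + k)) \<le> V"
  shows "(\<Sum>k<n. lagr (\<beta> (a + k)) (y (a + k)) (z (a + k)) (x (a + k))
      - lagr (\<beta> (a + k)) (y (a + k)) (z (a + k)) (x (Suc (a + k))))
    \<le> 2 * Fmax + (7 / 2 * c\<^sup>2) / \<beta> 0 + (3 / 2 * c + Bp) * V"
proof -
  obtain a' where a': "a = Suc a'" using a by (cases a) auto
  have mono: "\<beta> i \<le> \<beta> j" if "i \<le> j" for i j using lift_Suc_mono_le[of \<beta>, OF \<beta>_mono that] .
  have cB: "0 \<le> c * Bp" using c_nonneg Bp_nonneg by simp
  have "3 / 2 * (c * Bp) / \<beta> (a + n) \<le> 3 / 2 * (c * Bp) / \<beta> a"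
    using cB \<beta>_pos mono[of a "a + n"] by (intro divide_left_mono mult_pos_pos) auto
  then have "pot a - pot (a + n) \<le> \<phi> (x a) - \<phi> (x (a + n))
      + (9 / 8 * c\<^sup>2 + 3 * (c * Bp) + Bp\<^sup>2 / 2) / \<beta> a + 3 / 2 * (c * Bp) / \<beta> a"
    using pot_upper[of a'] pot_lower[of "a' + n"] by (simp add: a')
  moreover have "\<phi> (x a) - \<phi> (x (a + n)) \<le> 2 * Fmax"
    using F[OF x_in, of a] F[OF x_in, of "a + n"] by linarith
  moreover have "3 / 4 * c\<^sup>2 * (1 / \<beta> a - 1 / \<beta> (a + n)) \<le> 3 / 4 * c\<^sup>2 / \<beta> a"
    using mult_left_mono[of "1 / \<beta> a - 1 / \<beta> (a + n)" "1 / \<beta> a" "3 / 4 * c\<^sup>2"] \<beta>_pos[of "a + n"] by simp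
  moreover have "(3 / 2 * c + Bp) * (\<Sum>k<n. v (a + k) / \<beta> (a + k)) \<le> (3 / 2 * c + Bp) * V"
    using c_nonneg Bp_nonneg v by (intro mult_left_mono) auto
  moreover have "(9 / 8 * c\<^sup>2 + 3 * (c * Bp) + Bp\<^sup>2 / 2) / \<beta> a + 3 / 2 * (c * Bp) / \<beta> a + 3 / 4 * c\<^sup>2 / \<beta> a
      \<le> (7 / 2 * c\<^sup>2) / \<beta> 0"
  proof -
    have "c * Bp \<le> c * (c / 4)" "Bp * Bp \<le> c / 4 * (c / 4)"
      using c c_nonneg Bp_nonneg by (intro mult_left_mono mult_mono; simp)+
    then have "9 / 8 * c\<^sup>2 + 3 * (c * Bp) + Bp\<^sup>2 / 2 + 3 / 2 * (c * Bp) + 3 / 4 * c\<^sup>2 \<le> 7 / 2 * c\<^sup>2"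
      using zero_le_square[of c] unfolding power2_eq_square by linarith
    then have "(9 / 8 * c\<^sup>2 + 3 * (c * Bp) + Bp\<^sup>2 / 2 + 3 / 2 * (c * Bp) + 3 / 4 * c\<^sup>2) / \<beta> a \<le> (7 / 2 * c\<^sup>2) / \<beta> 0"
      using \<beta>_pos mono[of 0 a] by (intro frac_le) auto
    then show ?thesis by (simp add: add_divide_distrib)
  qed
  ultimately show ?thesis using sum_lagr_diff_le[where a = a and n = n] by linarith
qed

end

section \<open>From extended-real-valued functions to the real program\<close>

text \<open>A ball is connected, so if it meets both \<open>S\<close> and its complement, it meets
  the frontier, which lies at least one radius away.\<close>

lemma ball_infdist_frontier_subset:
  fixes p :: "'a::real_normed_vector"
  assumes "p \<in> S"
  shows "ball p (infdist p (frontier S)) \<subseteq> S"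
proof (rule ccontr)
  let ?B = "ball p (infdist p (frontier S))"
  assume n: "\<not> ?B \<subseteq> S"
  then obtain r where "r \<in> ?B" by blast
  then have "dist p r < infdist p (frontier S)" by simp
  then have "0 < infdist p (frontier S)" by (rule le_less_trans[OF zero_le_dist])
  then have "p \<in> ?B" by simp
  then have "?B \<inter> frontier S \<noteq> {}"
    using n assms by (intro connected_Int_frontier connected_ball) blast+
  then obtain q where "q \<in> frontier S" "dist p q < infdist p (frontier S)" by auto
  then show False using infdist_le[of q "frontier S" p] by simp
qed

text \<open>A step along \<open>n\<close> itself would stay in \<open>S\<close>. At interior points
  the assumption on \<open>h\<close> thus becomes a plain bound by \<open>r_h\<close>.\<close>

lemma normal_cone_interior:
  assumes p: "p \<in> interior S" and n: "n \<in> normal_cone S p"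
  shows "n = 0"
proof (rule ccontr)
  assume "n \<noteq> 0"
  obtain e where e: "0 < e" "cball p e \<subseteq> S"
    using p by (auto simp: mem_interior_cball)
  have "p + (e / norm n) *\<^sub>R n \<in> S"
    using e \<open>n \<noteq> 0\<close> by (intro subsetD[OF e(2)]) (simp add: dist_norm)
  then have "(e / norm n) * (n \<bullet> n) \<le> 0"
    using n by (auto simp: normal_cone_def)
  moreover have "0 < (e / norm n) * (n \<bullet> n)" using e \<open>n \<noteq> 0\<close> by simp
  ultimately show False by linarith
qed

lemma ereal_convex_onD:
  assumes conv: "ereal_convex_on S \<psi>" and "u \<in> S" "w \<in> S" "0 \<le> t" "t \<le> 1"
    and "\<psi> u = ereal p" "\<psi> w = ereal q"
  shows "u + t *\<^sub>R (w - u) \<in> S" "\<psi> (u + t *\<^sub>R (w - u)) \<le> ereal ((1 - t) * p + t * q)"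
proof -
  have "(1 - t) *\<^sub>R (u, p) + t *\<^sub>R (w, q) \<in> ereal_epigraph_on S \<psi>"
    by (rule convexD) (use assms in \<open>auto simp: ereal_convex_on_def ereal_epigraph_on_def\<close>)
  moreover have "(1 - t) *\<^sub>R u + t *\<^sub>R w = u + t *\<^sub>R (w - u)" by (simp add: algebra_simps)
  ultimately show "u + t *\<^sub>R (w - u) \<in> S" "\<psi> (u + t *\<^sub>R (w - u)) \<le> ereal ((1 - t) * p + t * q)"
    by (simp_all add: ereal_epigraph_on_def)
qed

lemma norm_squared_convex_comb:
  fixes u w :: "'a::real_inner"
  shows "(norm (u + t *\<^sub>R (w - u)))\<^sup>2
    = (1 - t) * (norm u)\<^sup>2 + t * (norm w)\<^sup>2 - t * (1 - t) * (norm (w - u))\<^sup>2"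
proof -
  have "u \<bullet> w = w \<bullet> u" by (rule inner_commute)
  then show ?thesis
    unfolding power2_norm_eq_inner
    by (simp add: inner_add_left inner_add_right inner_diff_left inner_diff_right algebra_simps)
qed

lemma norm_squared_diff:
  fixes u w :: "'a::real_inner"
  shows "(norm w)\<^sup>2 = (norm u)\<^sup>2 + 2 * (u \<bullet> (w - u)) + (norm (w - u))\<^sup>2"
proof -
  have "u \<bullet> w = w \<bullet> u" by (rule inner_commute)
  then show ?thesis
    unfolding power2_norm_eq_inner by (simp add: inner_diff_left inner_diff_right)
qed

locale composite_program =
  fixes f h F :: "real^'d \<Rightarrow> ereal" and A :: "real^'d^'n" and b :: "real^'n"
    and g :: "real^'d \<Rightarrow> real^'m" and X :: "(real^'d) set" and xfeas :: "real^'d"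
    and \<rho> L_g B_g r_h B_f :: real
  assumes f_proper: "\<And>u. f u \<noteq> -\<infinity>" and h_proper: "\<And>u. h u \<noteq> -\<infinity>"
    and F_eq: "F = (\<lambda>u. f u + h u)" and X_eq: "X = effective_dom F"
    and F_cont: "continuous_on X F" and X_compact: "compact X"
    and rho_pos: "\<rho> > 0" and f_weakly_convex: "weakly_convex_on \<rho> X f"
    and h_convex: "ereal_convex_on UNIV h"
    and g_smooth: "\<And>i. \<exists>U. open U \<and> X \<subseteq> U \<and> convex_on U (\<lambda>u. g u $ i) \<and>
          (\<forall>u\<in>U. (\<lambda>u. g u $ i) differentiable (at u)) \<and>
          L_g-lipschitz_on U (grad (\<lambda>u. g u $ i))"
    and xfeas: "xfeas \<in> interior X" "A *v xfeas = b"
    and r_h_pos: "r_h > 0"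
    and h_subdiff: "\<And>u. u \<in> X \<Longrightarrow> subdifferential h u \<noteq> {} \<and>
          subdifferential h u \<subseteq> {p + w | p w. p \<in> normal_cone X u \<and> norm w \<le> r_h}"
    and f_subdiff: "\<And>u \<xi>. u \<in> X \<Longrightarrow> \<xi> \<in> local_weak_subdifferential \<rho> f u \<Longrightarrow> norm \<xi> \<le> B_f"
    and B_g_pos: "B_g > 0"
    and B_g_lip: "\<And>u u' i. u \<in> X \<Longrightarrow> u' \<in> X \<Longrightarrow> \<bar>g u $ i - g u' $ i\<bar> \<le> B_g * norm (u - u')"
begin

section \<open>Real-valued parts and one-sided slope bounds\<close>

definition "fr u = real_of_ereal (f u)"
definition "hr u = real_of_ereal (h u)"
definition "\<phi> u = real_of_ereal (F u)"

lemma real_parts: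
  assumes "u \<in> X"
  shows "f u = ereal (fr u)" "h u = ereal (hr u)" "F u = ereal (\<phi> u)" "\<phi> u = fr u + hr u"
proof -
  have "f u + h u < \<infinity>" using assms by (simp add: X_eq effective_dom_def F_eq)
  then have "\<bar>f u\<bar> \<noteq> \<infinity>" "\<bar>h u\<bar> \<noteq> \<infinity>"
    using f_proper[of u] h_proper[of u] by (cases "f u"; cases "h u"; simp)+
  then show 1: "f u = ereal (fr u)" "h u = ereal (hr u)"
    by (simp_all add: fr_def hr_def ereal_real)
  then have "F u = ereal (fr u + hr u)" by (subst F_eq) simp
  then show "F u = ereal (\<phi> u)" "\<phi> u = fr u + hr u"
    by (simp_all add: \<phi>_def)
qed

lemma F_outside: "u \<notin> X \<Longrightarrow> F u = \<infinity>"
  by (simp add: X_eq effective_dom_def)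

lemma X_convex: "convex X"
  using f_weakly_convex by (simp add: weakly_convex_on_def ereal_convex_on_def)

lemma add_quadratic_f: "u \<in> X \<Longrightarrow> add_quadratic \<rho> f u = ereal (fr u + \<rho> / 2 * (norm u)\<^sup>2)"
  by (simp add: add_quadratic_def real_parts)

lemma fr_convex:
  assumes "u \<in> X" "w \<in> X" "0 \<le> t" "t \<le> 1"
  shows "fr (u + t *\<^sub>R (w - u)) + \<rho> / 2 * (norm (u + t *\<^sub>R (w - u)))\<^sup>2
    \<le> (1 - t) * (fr u + \<rho> / 2 * (norm u)\<^sup>2) + t * (fr w + \<rho> / 2 * (norm w)\<^sup>2)"
  using ereal_convex_onD[OF f_weakly_convex[unfolded weakly_convex_on_def] assms
      add_quadratic_f add_quadratic_f] assms
  by (simp add: add_quadratic_f)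

lemma hr_convex:
  assumes "u \<in> X" "w \<in> X" "0 \<le> t" "t \<le> 1"
  shows "hr (u + t *\<^sub>R (w - u)) \<le> (1 - t) * hr u + t * hr w"
proof -
  have "u + t *\<^sub>R (w - u) \<in> X"
    using convexD_alt[OF X_convex assms] by (simp add: algebra_simps)
  moreover have "h (u + t *\<^sub>R (w - u)) \<le> ereal ((1 - t) * hr u + t * hr w)"
    using assms by (intro ereal_convex_onD[OF h_convex]) (simp_all add: real_parts)
  ultimately show ?thesis by (simp add: real_parts)
qed

lemma \<phi>_weakly_convex:
  assumes "u \<in> X" "w \<in> X" "0 \<le> t" "t \<le> 1"
  shows "\<phi> (u + t *\<^sub>R (w - u)) \<le> (1 - t) * \<phi> u + t * \<phi> w + \<rho> / 2 * t * (1 - t) * (norm (w - u))\<^sup>2"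
proof -
  have "u + t *\<^sub>R (w - u) \<in> X"
    using convexD_alt[OF X_convex assms] by (simp add: algebra_simps)
  then have "\<phi> (u + t *\<^sub>R (w - u)) = fr (u + t *\<^sub>R (w - u)) + hr (u + t *\<^sub>R (w - u))"
    "\<phi> u = fr u + hr u" "\<phi> w = fr w + hr w"
    using assms by (simp_all add: real_parts(4))
  moreover have "\<rho> / 2 * (norm (u + t *\<^sub>R (w - u)))\<^sup>2 = (1 - t) * (\<rho> / 2 * (norm u)\<^sup>2)
      + t * (\<rho> / 2 * (norm w)\<^sup>2) - \<rho> / 2 * t * (1 - t) * (norm (w - u))\<^sup>2"
    unfolding norm_squared_convex_comb by (simp add: algebra_simps diff_divide_distrib add_divide_distrib)
  ultimately show ?thesis
    using fr_convex[OF assms] hr_convex[OF assms] by (simp only: distrib_left)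
qed

text \<open>On the open interior, \<open>fr\<close> plus the quadratic is a real convex function and
  has a subgradient there. It is a local one, so the bound \<open>B_f\<close> applies to it, and
  convexity on all of \<open>X\<close> extends its inequality to boundary points.\<close>

lemma subgradient_f_interior:
  assumes p: "p \<in> interior X"
  obtains \<xi> where "norm \<xi> \<le> B_f"
    "\<And>q. q \<in> X \<Longrightarrow> fr p + \<xi> \<bullet> (q - p) \<le> fr q + \<rho> / 2 * (norm (q - p))\<^sup>2"
proof -
  have pX: "p \<in> X" using p interior_subset by blast
  have sub: "u \<in> X" if "u \<in> interior X" for u using that interior_subset by blast
  have "convex_on (interior X) (\<lambda>u. fr u + \<rho> / 2 * (norm u)\<^sup>2)"
  proof (rule convex_onI)
    fix t u w assume h: "0 < t" "t < (1::real)" "u \<in> interior X" "w \<in> interior X"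
    have "(1 - t) *\<^sub>R u + t *\<^sub>R w = u + t *\<^sub>R (w - u)" by (simp add: algebra_simps)
    then show "fr ((1 - t) *\<^sub>R u + t *\<^sub>R w) + \<rho> / 2 * (norm ((1 - t) *\<^sub>R u + t *\<^sub>R w))\<^sup>2
      \<le> (1 - t) * (fr u + \<rho> / 2 * (norm u)\<^sup>2) + t * (fr w + \<rho> / 2 * (norm w)\<^sup>2)"
      using fr_convex[of u w t] h sub by simp
  qed (rule convex_interior[OF X_convex])
  from convex_on_subgradient_exists[OF open_interior this p]
  obtain \<xi> where \<xi>: "\<And>q. q \<in> interior X \<Longrightarrow>
      fr p + \<rho> / 2 * (norm p)\<^sup>2 + \<xi> \<bullet> (q - p) \<le> fr q + \<rho> / 2 * (norm q)\<^sup>2" by blast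
  have loc: "\<xi> \<in> subdifferential_on (interior X) (add_quadratic \<rho> f) p"
    using \<xi> pX sub by (auto simp: subdifferential_on_def add_quadratic_f)
  then have "\<xi> - \<rho> *\<^sub>R p \<in> local_weak_subdifferential \<rho> f p"
    unfolding local_weak_subdifferential_def using p by blast
  then have "norm (\<xi> - \<rho> *\<^sub>R p) \<le> B_f" by (rule f_subdiff[OF pX])
  moreover have "fr p + (\<xi> - \<rho> *\<^sub>R p) \<bullet> (q - p) \<le> fr q + \<rho> / 2 * (norm (q - p))\<^sup>2" if q: "q \<in> X" for q
  proof -
    have "\<xi> \<in> subdifferential_on X (add_quadratic \<rho> f) p"
      using local_subgradient_imp_global[OF _ open_interior p pX loc] f_weakly_convex
      by (simp add: weakly_convex_on_def)
    then have "fr p + \<rho> / 2 * (norm p)\<^sup>2 + \<xi> \<bullet> (q - p) \<le> fr q + \<rho> / 2 * (norm q)\<^sup>2"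
      using q pX by (auto simp: subdifferential_on_def add_quadratic_f)
    moreover have "\<rho> / 2 * (norm q)\<^sup>2
        = \<rho> / 2 * (norm p)\<^sup>2 + \<rho> * (p \<bullet> (q - p)) + \<rho> / 2 * (norm (q - p))\<^sup>2"
      by (subst norm_squared_diff[of q p]) (simp add: distrib_left)
    moreover have "(\<xi> - \<rho> *\<^sub>R p) \<bullet> (q - p) = \<xi> \<bullet> (q - p) - \<rho> * (p \<bullet> (q - p))"
      by (simp only: inner_diff_left[of \<xi>] inner_scaleR_left)
    ultimately show ?thesis by linarith
  qed
  ultimately show ?thesis by (rule that)
qed

lemma B_f_nonneg: "0 \<le> B_f"
  using subgradient_f_interior[OF xfeas(1)] norm_ge_zero order_trans by metis

lemma subgradient_h_interior:
  assumes p: "p \<in> interior X"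
  obtains \<eta> where "norm \<eta> \<le> r_h" "\<And>q. q \<in> X \<Longrightarrow> hr p + \<eta> \<bullet> (q - p) \<le> hr q"
proof -
  have pX: "p \<in> X" using p interior_subset by blast
  then obtain \<eta> where \<eta>: "\<eta> \<in> subdifferential h p" using h_subdiff by blast
  then obtain n w where nw: "\<eta> = n + w" "n \<in> normal_cone X p" "norm w \<le> r_h"
    using h_subdiff[OF pX] by blast
  have "n = 0" by (rule normal_cone_interior[OF p nw(2)])
  then have "norm \<eta> \<le> r_h" using nw by simp
  moreover have "hr p + \<eta> \<bullet> (q - p) \<le> hr q" if "q \<in> X" for q
  proof -
    have "h p + ereal (\<eta> \<bullet> (q - p)) \<le> h q" using \<eta> by (simp add: subdifferential_on_def)
    then show ?thesis using pX that by (simp add: real_parts)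
  qed
  ultimately show ?thesis by (rule that)
qed

lemma \<phi>_slope:
  assumes p: "p \<in> interior X" and q: "q \<in> X"
  shows "\<phi> p - \<phi> q \<le> (B_f + r_h) * norm (p - q) + \<rho> / 2 * (norm (p - q))\<^sup>2"
proof -
  have pX: "p \<in> X" using p interior_subset by blast
  obtain \<xi> where \<xi>: "norm \<xi> \<le> B_f" "fr p + \<xi> \<bullet> (q - p) \<le> fr q + \<rho> / 2 * (norm (q - p))\<^sup>2"
    using subgradient_f_interior[OF p] q by metis
  obtain \<eta> where \<eta>: "norm \<eta> \<le> r_h" "hr p + \<eta> \<bullet> (q - p) \<le> hr q"
    using subgradient_h_interior[OF p] q by metis
  have bound: "- (\<zeta> \<bullet> (q - p)) \<le> B * norm (p - q)" if "norm \<zeta> \<le> B" for \<zeta> B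
  proof -
    have "- (\<zeta> \<bullet> (q - p)) \<le> norm \<zeta> * norm (q - p)"
      using Cauchy_Schwarz_ineq2[of \<zeta> "q - p"] by linarith
    also have "\<dots> \<le> B * norm (q - p)" using that by (intro mult_right_mono) auto
    finally show ?thesis by (simp add: norm_minus_commute)
  qed
  show ?thesis
    using \<xi>(2) \<eta>(2) bound[OF \<xi>(1)] bound[OF \<eta>(1)] real_parts(4)[OF pX] real_parts(4)[OF q]
    by (simp add: distrib_right norm_minus_commute)
qed

lemma g_differentiable:
  assumes "u \<in> X"
  shows "g differentiable (at u)"
proof -
  have "\<forall>i\<in>Basis. (\<lambda>u. g u \<bullet> i) differentiable at u"
  proof
    fix i :: "real^'m" assume "i \<in> Basis"
    then obtain k where "i = axis k 1" by (auto simp: Basis_vec_def)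
    then have "(\<lambda>u. g u \<bullet> i) = (\<lambda>u. g u $ k)" by (simp add: inner_axis)
    then show "(\<lambda>u. g u \<bullet> i) differentiable at u"
      using g_smooth[of k] assms by (metis subsetD)
  qed
  then show ?thesis using differentiable_componentwise_within[of g u UNIV] by simp
qed

lemma g_component_convex: "convex_on X (\<lambda>u. g u $ i)"
  using g_smooth[of i] X_convex convex_on_subset by metis

lemma \<phi>_continuous: "continuous_on X \<phi>"
proof -
  have "continuous_on X (real_of_ereal \<circ> F)"
    using F_cont continuous_on_iff_real[of X F] real_parts(3) by simp
  then show ?thesis by (simp add: \<phi>_def[abs_def] o_def)
qed

sublocale weakly_convex_program \<phi> X A b g \<rho> "B_f + r_h" B_g xfeas
  by unfold_locales
     (use X_compact X_convex \<phi>_continuous rho_pos \<phi>_weakly_convex \<phi>_slope B_f_nonneg r_h_pos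
        g_differentiable g_component_convex B_g_pos B_g_lip xfeas in auto)

section \<open>Subproblems and KKT points in extended-real form\<close>

lemma prox_aug_lagrangian_eq:
  "w \<in> X \<Longrightarrow> prox_aug_lagrangian F A b g \<rho> \<beta> c w y z = ereal (lagr \<beta> y z w + \<rho> * (norm (w - c))\<^sup>2)"
  "w \<notin> X \<Longrightarrow> prox_aug_lagrangian F A b g \<rho> \<beta> c w y z = \<infinity>"
  by (simp_all add: prox_aug_lagrangian_def aug_lagrangian_def real_parts(3) F_outside
      lagr_def smooth_part_def)

text \<open>Values outside \<open>X\<close> are infinite, so the infimum over the whole space is the
  finite value at \<open>u\<close>, and a finite gap excludes \<open>w\<close> outside
  \<open>X\<close>.\<close>

lemma approximate_minimizer:
  assumes min: "prox_minimizer c \<beta> y z u"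
    and le: "prox_aug_lagrangian F A b g \<rho> \<beta> c w y z
      - (INF u. prox_aug_lagrangian F A b g \<rho> \<beta> c u y z) \<le> ereal e"
  shows "w \<in> X" "lagr \<beta> y z w + \<rho> * (norm (w - c))\<^sup>2 \<le> lagr \<beta> y z u + \<rho> * (norm (u - c))\<^sup>2 + e"
proof -
  let ?L = "\<lambda>w. prox_aug_lagrangian F A b g \<rho> \<beta> c w y z"
  have u: "u \<in> X" using min by (simp add: prox_minimizer_def)
  have "(INF w. ?L w) = ?L u"
  proof (rule antisym)
    show "?L u \<le> (INF w. ?L w)"
    proof (rule INF_greatest)
      fix w show "?L u \<le> ?L w"
        using min u by (cases "w \<in> X") (auto simp: prox_aug_lagrangian_eq prox_minimizer_def)
    qed
  qed (rule INF_lower, simp)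
  then have le': "?L w - ereal (lagr \<beta> y z u + \<rho> * (norm (u - c))\<^sup>2) \<le> ereal e"
    using le u by (simp add: prox_aug_lagrangian_eq)
  show w: "w \<in> X"
  proof (rule ccontr)
    assume "w \<notin> X"
    then show False using le' by (simp add: prox_aug_lagrangian_eq)
  qed
  show "lagr \<beta> y z w + \<rho> * (norm (w - c))\<^sup>2 \<le> lagr \<beta> y z u + \<rho> * (norm (u - c))\<^sup>2 + e"
    using le' w by (simp add: prox_aug_lagrangian_eq)
qed

text \<open>After completion of the square, the variational inequality is literally the subgradient
  inequality for \<open>F\<close> plus its quadratic, so membership in the weak subdifferential of
  \<open>F\<close> needs no sum rule. The gradient of the proximal term is what remains.\<close>

lemma stationarity_at_minimizer:
  assumes min: "prox_minimizer c \<beta> y z u" and \<beta>: "\<beta> > 0"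
  shows "- (2 * \<rho>) *\<^sub>R (u - c)
    \<in> stationarity_set \<rho> F A g u (eq_multiplier A b \<beta> y u) (ineq_multiplier g \<beta> z u)"
proof -
  let ?\<xi> = "- (lagr_grad \<beta> y z u + (2 * \<rho>) *\<^sub>R (u - c))"
  have u: "u \<in> X" using min by (simp add: prox_minimizer_def)
  have aq: "add_quadratic \<rho> F u = ereal (\<phi> u + \<rho> / 2 * (norm u)\<^sup>2)" if "u \<in> X" for u
    using that by (simp add: add_quadratic_def real_parts(3))
  have "?\<xi> + \<rho> *\<^sub>R u \<in> subdifferential (add_quadratic \<rho> F) u"
    unfolding subdifferential_on_def
  proof (intro CollectI conjI ballI)
    fix w
    show "add_quadratic \<rho> F u + ereal ((?\<xi> + \<rho> *\<^sub>R u) \<bullet> (w - u)) \<le> add_quadratic \<rho> F w"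
    proof (cases "w \<in> X")
      case True
      have "\<rho> / 2 * (norm w)\<^sup>2 = \<rho> / 2 * (norm u)\<^sup>2 + \<rho> * (u \<bullet> (w - u)) + \<rho> / 2 * (norm (w - u))\<^sup>2"
        by (subst norm_squared_diff[of w u]) (simp add: distrib_left)
      moreover have "(?\<xi> + \<rho> *\<^sub>R u) \<bullet> (w - u)
          = - ((lagr_grad \<beta> y z u + (2 * \<rho>) *\<^sub>R (u - c)) \<bullet> (w - u)) + \<rho> * (u \<bullet> (w - u))"
        by (simp only: inner_add_left[of ?\<xi>] inner_minus_left inner_scaleR_left[of \<rho>])
      ultimately have "\<phi> u + \<rho> / 2 * (norm u)\<^sup>2 + (?\<xi> + \<rho> *\<^sub>R u) \<bullet> (w - u) \<le> \<phi> w + \<rho> / 2 * (norm w)\<^sup>2"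
        using prox_minimizer_variational[OF min \<beta> True] by linarith
      then show ?thesis by (simp only: aq[OF u] aq[OF True] plus_ereal.simps ereal_less_eq)
    next
      case False
      then show ?thesis by (simp add: add_quadratic_def F_outside)
    qed
  qed (use u in \<open>simp add: aq\<close>)
  then have "?\<xi> \<in> weak_subdifferential \<rho> F u"
    unfolding weak_subdifferential_def by (rule rev_image_eqI) simp
  moreover have "- (2 * \<rho>) *\<^sub>R (u - c) = ?\<xi> + transpose (jacobian g (at u)) *v ineq_multiplier g \<beta> z u
      + transpose A *v eq_multiplier A b \<beta> y u"
    by (simp add: lagr_grad_def algebra_simps del: transpose_matrix_vector)
  ultimately show ?thesis unfolding stationarity_set_def by blast
qed

lemma eps_kkt_point_at_minimizer:
  assumes min: "prox_minimizer c \<beta> y z u" and \<beta>: "\<beta> > 0"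
    and "2 * \<rho> * norm (u - c) \<le> \<epsilon>"
    and "constraint_violation A b g u \<le> \<epsilon>"
    and "(\<Sum>i\<in>UNIV. \<bar>ineq_multiplier g \<beta> z u $ i * g u $ i\<bar>) \<le> \<epsilon>"
  shows "eps_kkt_point \<rho> F A b g \<epsilon> u"
proof -
  note st = stationarity_at_minimizer[OF min \<beta>]
  have "infdist 0 (stationarity_set \<rho> F A g u (eq_multiplier A b \<beta> y u) (ineq_multiplier g \<beta> z u))
      \<le> dist 0 (- (2 * \<rho>) *\<^sub>R (u - c))"
    using st by (rule infdist_le)
  also have "\<dots> = 2 * \<rho> * norm (u - c)" using rho_pos by (simp add: dist_norm)
  finally have "infdist 0 (stationarity_set \<rho> F A g u (eq_multiplier A b \<beta> y u) (ineq_multiplier g \<beta> z u)) \<le> \<epsilon>"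
    using assms by linarith
  moreover have "u \<in> X" using min by (simp add: prox_minimizer_def)
  then have "u \<in> effective_dom F" using X_eq by simp
  ultimately show ?thesis
    unfolding eps_kkt_point_def using st assms
    by (intro conjI exI[of _ "eq_multiplier A b \<beta> y u"] exI[of _ "ineq_multiplier g \<beta> z u"]) auto
qed

end

theorem theorem5:
  fixes f h F :: "real^'d \<Rightarrow> ereal"
    and A :: "real^'d^'n" and b :: "real^'n"
    and g :: "real^'d \<Rightarrow> real^'m"
    and X :: "(real^'d) set" and xfeas :: "real^'d"
    and x :: "nat \<Rightarrow> real^'d" and y :: "nat \<Rightarrow> real^'n" and z :: "nat \<Rightarrow> real^'m"
    and \<beta> v \<alpha> \<epsilon>s \<delta> :: "nat \<Rightarrow> real"
    and \<epsilon> \<rho> L_g B_g r_h B_f \<beta>0 v0 D gmin dbd \<tau> Bbar \<theta> Bp Q C1 Cp_hat Cp Cx :: real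
    and K1 K2 :: int
  assumes eps_pos: "\<epsilon> > 0"
    \<comment> \<open>the problem\<close>
    and f_proper: "\<And>u. f u \<noteq> -\<infinity>" and h_proper: "\<And>u. h u \<noteq> -\<infinity>"
    and F_eq: "F = (\<lambda>u. f u + h u)"
    and X_eq: "X = effective_dom F"
    and F_cont: "continuous_on X F"
    \<comment> \<open>Assumption (1)\<close>
    and X_compact: "compact X" and D_eq: "D = diameter X"
    and rho_pos: "\<rho> > 0" and f_weakly_convex: "weakly_convex_on \<rho> X f"
    and h_convex: "ereal_convex_on UNIV h" and h_closed: "closed_fun h"
    \<comment> \<open>Assumption (2)\<close>
    and g_smooth: "\<And>i. \<exists>U. open U \<and> X \<subseteq> U \<and> convex_on U (\<lambda>u. g u $ i) \<and>
          (\<forall>u\<in>U. (\<lambda>u. g u $ i) differentiable (at u)) \<and>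
          L_g-lipschitz_on U (grad (\<lambda>u. g u $ i))"
    \<comment> \<open>Assumption (3)\<close>
    and xfeas: "xfeas \<in> interior X" "A *v xfeas = b"
    and gmin_eq: "gmin = Min (range (\<lambda>i. - (g xfeas $ i)))" and gmin_pos: "gmin > 0"
    \<comment> \<open>Assumption (4)\<close>
    and r_h_pos: "r_h > 0"
    and h_subdiff: "\<And>u. u \<in> X \<Longrightarrow> subdifferential h u \<noteq> {} \<and>
          subdifferential h u \<subseteq> {p + w | p w. p \<in> normal_cone X u \<and> norm w \<le> r_h}"
    \<comment> \<open>Assumption (5)\<close>
    and f_subdiff: "\<And>u \<xi>. u \<in> X \<Longrightarrow> \<xi> \<in> local_weak_subdifferential \<rho> f u \<Longrightarrow> norm \<xi> \<le> B_f"
    \<comment> \<open>the constant for the constraint functions\<close>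
    and B_g_pos: "B_g > 0"
    and B_g_bound: "\<And>u i. u \<in> X \<Longrightarrow> max \<bar>g u $ i\<bar> (norm (grad (\<lambda>u. g u $ i) u)) \<le> B_g"
    and B_g_lip: "\<And>u u' i. u \<in> X \<Longrightarrow> u' \<in> X \<Longrightarrow> \<bar>g u $ i - g u' $ i\<bar> \<le> B_g * norm (u - u')"
    \<comment> \<open>parameters of the method\<close>
    and beta0_pos: "\<beta>0 > 0" and v0_pos: "v0 > 0"
    and beta_eq: "\<And>k. \<beta> k = \<beta>0 * sqrt (real k + 1)"
    and v_0: "v 0 = v0"
    and v_eq: "\<And>k. k \<ge> 1 \<Longrightarrow> v k = v0 / (sqrt (real k + 1) * (ln (real k + 1))\<^sup>2)"
    and eps_eq: "\<And>k. \<epsilon>s k = Min {\<epsilon> / 4, \<rho> * \<epsilon> / sqrt 2, 1, sqrt (\<rho> / (2 * \<beta> k)),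
          1 / (\<beta> k * (real k + 2) * (ln (real k + 2))\<^sup>2)}"
    and delta_eq: "\<And>k. \<delta> k = sqrt 2 * \<epsilon>s k / \<rho>"
    \<comment> \<open>the iterates\<close>
    and init: "x 0 \<in> X" "y 0 \<in> range ((*v) A)" "\<And>i. 0 \<le> z 0 $ i"
    and x_step: "\<And>k. prox_aug_lagrangian F A b g \<rho> (\<beta> k) (x k) (x (Suc k)) (y k) (z k)
          - (INF u. prox_aug_lagrangian F A b g \<rho> (\<beta> k) (x k) u (y k) (z k))
          \<le> ereal ((\<epsilon>s k)\<^sup>2 / \<rho>)"
    and alpha_eq: "\<And>k. \<alpha> k = damped_step (\<beta> k) (v k) (constraint_violation A b g (x (Suc k)))"
    and y_step: "\<And>k. y (Suc k) = y k + \<alpha> k *\<^sub>R (A *v x (Suc k) - b)"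
    and z_step: "\<And>k. z (Suc k) =
          z k + \<alpha> k *\<^sub>R (\<chi> i. max (- (z k $ i) / \<beta> k) (g (x (Suc k)) $ i))"
    \<comment> \<open>the constants\<close>
    and dbd_eq: "dbd = infdist xfeas (frontier X)"
    and tau_eq: "\<tau> = min (gmin / (2 * sqrt (real CARD('m)) * B_g)) dbd"
    and Bbar_eq: "Bbar = D * (r_h + B_f) + 2 * \<rho> * D\<^sup>2 + D + \<tau> * (1 + r_h + B_f + 2 * \<rho> * D)"
    and theta_eq: "\<theta> = Bbar / theta_denom A \<tau> gmin"
    and Bp_eq: "Bp = max (norm (y 0, z 0)) \<theta>
          + (\<Sum>j. \<alpha> j * \<delta> j * (spectral_norm A + sqrt (real CARD('m)) * B_g))"
    and Q_eq: "Q = D * (B_f + 2 * \<rho> * D + r_h)"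
    and C1_eq: "C1 = 1 / D + 1 / dbd + B_g / gmin"
    and Cp_hat_eq: "Cp_hat = 2 * (Bp + sqrt (Q\<^sup>2 / gmin\<^sup>2
          + Q\<^sup>2 * (spectral_norm (pseudoinverse (A ** transpose A) ** A))\<^sup>2 * C1\<^sup>2)) + 1"
    and Cp_eq: "Cp = 2 * Cp_hat
          + (\<Sum>j. \<beta> j * \<delta> j * (spectral_norm A + sqrt (real CARD('m)) * B_g))"
    and Cx_eq: "Cx = 2 * (SUP u\<in>X. \<bar>real_of_ereal (F u)\<bar>)
          + 1 / (4 * \<beta>0) * (14 * Cp\<^sup>2 + 8 * Bp * Cp + 7 * Bp\<^sup>2)
          + (10 * Cp + 4 * Bp) * (v0 / \<beta>0)
          + \<beta>0 / 2 * ((norm (A *v x 0 - b))\<^sup>2 + (norm (pos_part (g (x 0) + z 0 /\<^sub>R \<beta>0)))\<^sup>2)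
          + \<bar>y 0 \<bullet> (A *v x 0 - b)\<bar>"
    and K1_eq: "K1 = \<lceil>max (Cp\<^sup>2 / \<beta>0\<^sup>2) ((Bp\<^sup>2 + 5 * Cp\<^sup>2 / 4)\<^sup>2 / \<beta>0\<^sup>2) / \<epsilon>\<^sup>2\<rceil>"
    and K2_eq: "K2 = \<lceil>16 * Cx * \<rho> / \<epsilon>\<^sup>2\<rceil>"
  shows "\<exists>k::nat. int k < K1 + K2 \<and> near_eps_kkt_point \<rho> F A b g \<epsilon> (x (Suc k))"
proof -
  interpret composite_program f h F A b g X xfeas \<rho> L_g B_g r_h B_f
    by unfold_locales fact+
  have \<beta>_pos: "0 < \<beta> k" for k using beta0_pos by (simp add: beta_eq)
  have \<beta>_mono: "\<beta> k \<le> \<beta> (Suc k)" for k using beta0_pos by (simp add: beta_eq)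
  \<comment> \<open>The quotient is largest at \<open>k = 0\<close>, where it is
    \<open>sqrt 2\<close>.\<close>
  have \<beta>_ratio: "\<beta> (Suc k) \<le> 3 / 2 * \<beta> k" for k
  proof -
    have "sqrt (real (Suc k) + 1) \<le> sqrt ((3 / 2)\<^sup>2 * (real k + 1))"
      by (rule real_sqrt_le_mono) (simp add: power2_eq_square)
    also have "\<dots> = 3 / 2 * sqrt (real k + 1)" by (simp add: real_sqrt_mult)
    finally show ?thesis
      using mult_left_mono[of _ _ \<beta>0] beta0_pos by (simp add: beta_eq mult.left_commute)
  qed
  \<comment> \<open>One series serves twice: the last entry of \<open>\<epsilon>s k\<close> is
    \<open>s k / \<beta> k\<close>, and \<open>v (Suc j) / \<beta> (Suc j)\<close> is a multiple of
    \<open>s j\<close>.\<close>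
  define s where "s k = 1 / ((real k + 2) * (ln (real k + 2))\<^sup>2)" for k
  have s_nonneg: "0 \<le> s k" for k by (simp add: s_def)
  have s_\<beta>: "s k / \<beta> k = 1 / (\<beta> k * (real k + 2) * (ln (real k + 2))\<^sup>2)" for k
    by (simp add: s_def mult_ac)
  have eps_le: "\<epsilon>s k \<le> \<epsilon> / 4" "\<epsilon>s k \<le> \<rho> * \<epsilon> / sqrt 2" "\<epsilon>s k \<le> s k / \<beta> k" for k
    unfolding eps_eq s_\<beta> by (rule Min_le; simp)+
  have eps_ge: "0 \<le> \<epsilon>s k" for k
    using eps_pos rho_pos \<beta>_pos[of k] by (simp add: eps_eq)
  have v_nonneg: "0 \<le> v k" for k
    using v0_pos v_0 v_eq[of k] by (cases "k = 0") auto
  have \<alpha>_nonneg: "0 \<le> \<alpha> k" for k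
    using \<beta>_pos[of k] v_nonneg[of k] constraint_violation_nonneg[of A b g]
    by (auto simp: alpha_eq damped_step_def)
  have \<alpha>_le: "\<alpha> k \<le> \<beta> k" for k by (simp add: alpha_eq damped_step_def)
  have \<alpha>_violation: "\<alpha> k * constraint_violation A b g (x (Suc k)) \<le> v k" for k
  proof (cases "constraint_violation A b g (x (Suc k)) = 0")
    case False
    then have pos: "0 < constraint_violation A b g (x (Suc k))"
      using constraint_violation_nonneg[of A b g "x (Suc k)"] by linarith
    have "\<alpha> k \<le> v k / constraint_violation A b g (x (Suc k))"
      using False by (simp add: alpha_eq damped_step_def)
    then show ?thesis using pos by (simp add: field_simps)
  qed (simp add: v_nonneg)

  have "\<forall>k. \<exists>w. prox_minimizer (x k) (\<beta> k) (y k) (z k) w"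
    using prox_minimizer_exists[OF \<beta>_pos] by metis
  then obtain u where u_min: "\<And>k. prox_minimizer (x k) (\<beta> k) (y k) (z k) (u k)" by metis
  have x_in: "x k \<in> X" for k
    using init(1) approximate_minimizer(1)[OF u_min x_step] by (cases k) auto
  note x_le = approximate_minimizer(2)[OF u_min x_step]
  have x_near: "norm (x (Suc k) - u k) \<le> \<delta> k" for k
  proof (rule power2_le_imp_le)
    have "\<rho> / 2 * (norm (x (Suc k) - u k))\<^sup>2 \<le> (\<epsilon>s k)\<^sup>2 / \<rho>"
      using prox_minimizer_quadratic_growth[OF u_min[of k] \<beta>_pos x_in[of "Suc k"]] x_le[of k] by linarith
    then show "(norm (x (Suc k) - u k))\<^sup>2 \<le> (\<delta> k)\<^sup>2"
      using rho_pos by (simp add: delta_eq power_divide power_mult_distrib field_simps power2_eq_square)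
    show "0 \<le> \<delta> k" using eps_ge[of k] rho_pos by (simp add: delta_eq)
  qed

  \<comment> \<open>Summability of the inexactness; the constants Bp and Cp\<close>
  define M where "M = spectral_norm A + sqrt (real CARD('m)) * B_g"
  have M_nonneg: "0 \<le> M" using spectral_norm_nonneg[of A] B_g_pos by (simp add: M_def)
  have \<delta>_nonneg: "0 \<le> \<delta> k" for k using x_near[of k] norm_ge_zero order_trans by blast
  have \<beta>\<delta>_nonneg: "0 \<le> \<beta> k * \<delta> k * M" for k
    using \<beta>_pos[of k] \<delta>_nonneg[of k] M_nonneg by simp
  have \<alpha>\<delta>_nonneg: "0 \<le> \<alpha> k * \<delta> k * M" for k
    using \<alpha>_nonneg[of k] \<delta>_nonneg[of k] M_nonneg by simp
  have \<beta>\<delta>_le: "\<beta> k * \<delta> k * M \<le> sqrt 2 / \<rho> * M * s k" for k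
  proof -
    have "\<beta> k * \<epsilon>s k \<le> s k" using eps_le(3)[of k] \<beta>_pos[of k] by (simp add: field_simps)
    then have "sqrt 2 / \<rho> * M * (\<beta> k * \<epsilon>s k) \<le> sqrt 2 / \<rho> * M * s k"
      using rho_pos M_nonneg by (intro mult_left_mono) auto
    then show ?thesis by (simp add: delta_eq mult_ac)
  qed
  have \<alpha>\<delta>_le: "\<alpha> k * \<delta> k * M \<le> \<beta> k * \<delta> k * M" for k
    using \<alpha>_le[of k] \<delta>_nonneg[of k] M_nonneg by (intro mult_right_mono)
  have "summable (\<lambda>k. sqrt 2 / \<rho> * M * s k)"
    unfolding s_def by (intro summable_mult summable_log_series)
  then have \<beta>\<delta>_summable: "summable (\<lambda>k. \<beta> k * \<delta> k * M)"
    by (rule summable_comparison_test'[where N = 0])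
       (use \<beta>\<delta>_le \<beta>\<delta>_nonneg in \<open>simp only: real_norm_def abs_of_nonneg\<close>)
  then have \<alpha>\<delta>_summable: "summable (\<lambda>k. \<alpha> k * \<delta> k * M)"
    by (rule summable_comparison_test'[where N = 0])
       (use \<alpha>\<delta>_le \<alpha>\<delta>_nonneg in \<open>simp only: real_norm_def abs_of_nonneg\<close>)
  have Bp: "max (norm (y 0, z 0)) \<theta> + (\<Sum>j<k. \<alpha> j * \<delta> j * M) \<le> Bp" for k
    unfolding Bp_eq M_def[symmetric]
    using sum_le_suminf[OF \<alpha>\<delta>_summable, of "{..<k}"] \<alpha>\<delta>_nonneg by auto
  have "norm (y 0, z 0) \<le> Bp" using Bp[of 0] by simp
  then have Bp_nonneg: "0 \<le> Bp" by (rule order_trans[OF norm_ge_zero])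
  have \<beta>\<delta>_sum: "\<beta> k * \<delta> k * M \<le> (\<Sum>j. \<beta> j * \<delta> j * M)" for k
    using sum_le_suminf[OF \<beta>\<delta>_summable, of "{k}"] \<beta>\<delta>_nonneg by simp
  \<comment> \<open>The summand 1 in \<open>Cp_hat\<close> yields the 2; it makes \<open>Cp\<close>
    strictly positive, on which \<open>K1 \<ge> 1\<close> and \<open>K2 \<ge> 1\<close>
    rest.\<close>
  have Cp: "4 * Bp + 2 + \<beta> k * \<delta> k * M \<le> Cp" for k
  proof -
    have "2 * Bp + 1 \<le> Cp_hat" by (simp add: Cp_hat_eq)
    then show ?thesis using \<beta>\<delta>_sum[of k] by (simp add: Cp_eq M_def)
  qed
  have Cp4: "4 * Bp \<le> Cp" and Cp_pos: "0 < Cp"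
    using Cp[of 0] \<beta>\<delta>_nonneg[of 0] Bp_nonneg by auto

  \<comment> \<open>The ball around the Slater point and the bound \<theta>\<close>
  have D: "norm (p - q) \<le> D" if "p \<in> X" "q \<in> X" for p q
    using diameter_bounded_bound[OF compact_imp_bounded[OF X_compact] that] by (simp add: D_eq dist_norm)
  have D_nonneg: "0 \<le> D" using D[OF init(1) init(1)] by simp
  \<comment> \<open>\<open>infdist\<close> to an empty frontier would be 0; a nonempty compact
    \<open>X\<close> is not the whole space, so its frontier is nonempty.\<close>
  have dbd: "0 < dbd"
    unfolding dbd_eq
  proof (rule infdist_pos_not_in_closed)
    show "frontier X \<noteq> {}"
      using init(1) X_compact compact_imp_bounded not_bounded_UNIV by (auto simp: frontier_eq_empty)
    show "xfeas \<notin> frontier X" using xfeas(1) by (simp add: frontier_def)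
  qed simp
  have sqrt_m: "1 \<le> sqrt (real CARD('m))" by simp
  have \<tau>_pos: "0 < \<tau>" using gmin_pos B_g_pos dbd by (simp add: tau_eq)
  have \<tau>_ball: "ball xfeas \<tau> \<subseteq> X"
  proof -
    have "\<tau> \<le> infdist xfeas (frontier X)" by (simp add: tau_eq dbd_eq)
    then show ?thesis using ball_infdist_frontier_subset[OF xfeas_in_X] subset_ball by blast
  qed
  have \<tau>_B_g: "B_g * \<tau> \<le> gmin / 2"
  proof -
    have "B_g * \<tau> \<le> B_g * (gmin / (2 * sqrt (real CARD('m)) * B_g))"
      using B_g_pos by (intro mult_left_mono) (auto simp: tau_eq)
    also have "\<dots> = gmin / (2 * sqrt (real CARD('m)))" using B_g_pos by simp
    also have "\<dots> \<le> gmin / 2" using gmin_pos sqrt_m by (intro divide_left_mono) auto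
    finally show ?thesis .
  qed
  have gmin_le: "gmin \<le> - g xfeas $ i" for i by (simp add: gmin_eq)
  have \<theta>: "(B_f + r_h + 2 * \<rho> * D) * D \<le> \<theta> * theta_denom A \<tau> gmin"
  proof -
    have "0 < theta_denom A \<tau> gmin"
      using \<tau>_pos gmin_pos lambda_min_pos_gt_0[of A] by (auto simp: theta_denom_def)
    then have "\<theta> * theta_denom A \<tau> gmin = Bbar" by (simp add: theta_eq)
    moreover have "0 \<le> \<tau> * (1 + r_h + B_f + 2 * \<rho> * D)"
      using \<tau>_pos r_h_pos B_f_nonneg rho_pos D_nonneg by simp
    moreover have "(B_f + r_h + 2 * \<rho> * D) * D = D * (r_h + B_f) + 2 * \<rho> * D\<^sup>2"
      by (simp add: power2_eq_square algebra_simps)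
    ultimately show ?thesis using D_nonneg by (simp add: Bbar_eq)
  qed
  have u_multiplier: "norm (eq_multiplier A b (\<beta> k) (y k) (u k), ineq_multiplier g (\<beta> k) (z k) (u k))
        \<le> max (norm (y k, z k)) \<theta>" if "y k \<in> range ((*v) A)" "\<And>i. 0 \<le> z k $ i" for k
    by (rule multiplier_bound[OF u_min \<beta>_pos x_in that D gmin_pos gmin_le \<tau>_pos \<tau>_ball \<tau>_B_g \<theta>])
  have c_bound: "2 * Bp + \<beta> k * \<delta> k * M \<le> Cp" for k
    using Cp[of k] Bp_nonneg by linarith
  interpret dpalm \<phi> X A b g \<rho> "B_f + r_h" B_g xfeas x u y z \<alpha> \<beta> v \<delta> M \<theta> Bp Cp
    by unfold_locales
       (fact M_def \<beta>_pos \<beta>_mono \<beta>_ratio \<alpha>_nonneg \<alpha>_le \<alpha>_violation x_in init(2,3) y_step z_step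
         u_min x_near u_multiplier Bp c_bound)+

  \<comment> \<open>Accuracy beyond K1 and decrease at a failure\<close>
  \<comment> \<open>Origin of \<open>K1\<close>: it is the index from which
    \<open>P / \<beta> k \<le> \<epsilon>\<close> for both numerators \<open>P\<close>, namely
    \<open>Cp\<close> and \<open>Bp\<^sup>2 + 5 * Cp\<^sup>2 / 4\<close>.\<close>
  have beta_eps: "P \<le> \<beta> k * \<epsilon>" if P: "0 \<le> P" and k: "P\<^sup>2 / \<beta>0\<^sup>2 / \<epsilon>\<^sup>2 \<le> real k + 1" for P k
  proof (rule power2_le_imp_le)
    show "P\<^sup>2 \<le> (\<beta> k * \<epsilon>)\<^sup>2"
      using k beta0_pos eps_pos by (simp add: beta_eq power_mult_distrib field_simps)
  qed (use \<beta>_pos[of k] eps_pos in simp)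
  have K1_ge: "Cp\<^sup>2 / \<beta>0\<^sup>2 / \<epsilon>\<^sup>2 \<le> real_of_int K1" "(Bp\<^sup>2 + 5 * Cp\<^sup>2 / 4)\<^sup>2 / \<beta>0\<^sup>2 / \<epsilon>\<^sup>2 \<le> real_of_int K1"
  proof -
    have "max (Cp\<^sup>2 / \<beta>0\<^sup>2) ((Bp\<^sup>2 + 5 * Cp\<^sup>2 / 4)\<^sup>2 / \<beta>0\<^sup>2) / \<epsilon>\<^sup>2 \<le> real_of_int K1"
      by (simp only: K1_eq le_of_int_ceiling)
    then show "Cp\<^sup>2 / \<beta>0\<^sup>2 / \<epsilon>\<^sup>2 \<le> real_of_int K1" "(Bp\<^sup>2 + 5 * Cp\<^sup>2 / 4)\<^sup>2 / \<beta>0\<^sup>2 / \<epsilon>\<^sup>2 \<le> real_of_int K1"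
      by (smt (verit, best) divide_right_mono zero_le_power2)+
  qed
  have K1_pos: "1 \<le> K1"
  proof -
    have "0 < Cp\<^sup>2 / \<beta>0\<^sup>2 / \<epsilon>\<^sup>2" using Cp_pos beta0_pos eps_pos by simp
    then show ?thesis using K1_ge(1) by linarith
  qed
  have near: "near_eps_kkt_point \<rho> F A b g \<epsilon> (x (Suc k))"
    if k: "nat K1 \<le> k" and small: "2 * \<rho> * norm (u k - x k) \<le> \<epsilon>" for k
  proof -
    have kK: "real_of_int K1 \<le> real k + 1" using k by linarith
    have "Cp \<le> \<beta> k * \<epsilon>" by (rule beta_eps) (use K1_ge(1) kK Cp_pos in auto)
    then have "2 * Bp / \<beta> k \<le> \<epsilon>"
      using Cp4 Bp_nonneg \<beta>_pos[of k] by (simp add: field_simps)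
    then have 1: "constraint_violation A b g (u k) \<le> \<epsilon>" using violation_u_le[of k] by linarith
    have "Bp\<^sup>2 + 5 * Cp\<^sup>2 / 4 \<le> \<beta> k * \<epsilon>" by (rule beta_eps) (use K1_ge(2) kK in auto)
    moreover have "Bp\<^sup>2 \<le> Cp\<^sup>2" using Cp4 Bp_nonneg by (intro power_mono) auto
    ultimately have "2 * Bp\<^sup>2 \<le> \<beta> k * \<epsilon>" using zero_le_power2[of Cp] by linarith
    then have "2 * Bp\<^sup>2 / \<beta> k \<le> \<epsilon>" using \<beta>_pos[of k] by (simp add: field_simps)
    then have 2: "(\<Sum>i\<in>UNIV. \<bar>ineq_multiplier g (\<beta> k) (z k) (u k) $ i * g (u k) $ i\<bar>) \<le> \<epsilon>"
      using complementarity_u_le[of k] by linarith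
    have "\<delta> k \<le> sqrt 2 * (\<rho> * \<epsilon> / sqrt 2) / \<rho>"
      unfolding delta_eq using eps_le(2)[of k] rho_pos by (intro divide_right_mono mult_left_mono) auto
    then have "norm (x (Suc k) - u k) \<le> \<epsilon>" using x_near[of k] rho_pos by simp
    then show ?thesis
      unfolding near_eps_kkt_point_def
      using eps_kkt_point_at_minimizer[OF u_min \<beta>_pos small 1 2] by blast
  qed
  \<comment> \<open>Quadratic growth at \<open>x k\<close> gains more than
    \<open>\<epsilon>\<^sup>2 / (8 * \<rho>)\<close>; the entry \<open>\<epsilon> / 4\<close> of
    \<open>\<epsilon>s k\<close> ensures that inexactness costs at most half of it.\<close>
  have decrease: "\<epsilon>\<^sup>2 / (16 * \<rho>) < lagr (\<beta> k) (y k) (z k) (x k) - lagr (\<beta> k) (y k) (z k) (x (Suc k))"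
    if "\<epsilon> < 2 * \<rho> * norm (u k - x k)" for k
  proof -
    have "\<epsilon>\<^sup>2 < (2 * \<rho> * norm (u k - x k))\<^sup>2"
      using that eps_pos by (intro power_strict_mono) auto
    then have 1: "\<epsilon>\<^sup>2 / (8 * \<rho>) < \<rho> / 2 * (norm (x k - u k))\<^sup>2"
      using rho_pos by (simp add: field_simps power_mult_distrib norm_minus_commute power2_eq_square)
    have "(\<epsilon>s k)\<^sup>2 / \<rho> \<le> (\<epsilon> / 4)\<^sup>2 / \<rho>"
      using eps_le(1)[of k] eps_ge[of k] rho_pos by (intro divide_right_mono power_mono) auto
    then have 2: "(\<epsilon>s k)\<^sup>2 / \<rho> \<le> \<epsilon>\<^sup>2 / (16 * \<rho>)" by (simp add: power_divide)
    have 3: "\<epsilon>\<^sup>2 / (8 * \<rho>) = \<epsilon>\<^sup>2 / (16 * \<rho>) + \<epsilon>\<^sup>2 / (16 * \<rho>)" by simp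
    have "0 \<le> \<rho> * (norm (x (Suc k) - x k))\<^sup>2" using rho_pos by simp
    moreover have "lagr (\<beta> k) (y k) (z k) (u k) + \<rho> * (norm (u k - x k))\<^sup>2 + \<rho> / 2 * (norm (x k - u k))\<^sup>2
        \<le> lagr (\<beta> k) (y k) (z k) (x k)"
      using prox_minimizer_quadratic_growth[OF u_min[of k] \<beta>_pos x_in[of k]] by simp
    ultimately show ?thesis using 1 2 3 x_le[of k] by linarith
  qed

  \<comment> \<open>Total decrease after K1\<close>
  define Fmax where "Fmax = (SUP u\<in>X. \<bar>real_of_ereal (F u)\<bar>)"
  have bdd: "bdd_above ((\<lambda>u. \<bar>real_of_ereal (F u)\<bar>) ` X)"
  proof -
    have "compact ((\<lambda>u. \<bar>\<phi> u\<bar>) ` X)"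
      by (intro compact_continuous_image continuous_intros \<phi>_continuous X_compact)
    then show ?thesis by (simp add: \<phi>_def bounded_imp_bdd_above compact_imp_bounded)
  qed
  have F_le: "\<bar>\<phi> w\<bar> \<le> Fmax" if "w \<in> X" for w
    unfolding Fmax_def \<phi>_def using bdd that by (intro cSUP_upper)
  \<comment> \<open>The closed form of \<open>v\<close> starts at index 1; writing the start as a
    successor also aligns \<open>v\<close> with \<open>s\<close>, whose denominators start at
    2.\<close>
  obtain a' where a': "nat K1 = Suc a'" using K1_pos by (cases "nat K1") auto
  have v_sum: "(\<Sum>k<n. v (nat K1 + k) / \<beta> (nat K1 + k)) \<le> v0 / \<beta>0 * 4" for n
  proof -
    have vb: "v (Suc j) / \<beta> (Suc j) = v0 / \<beta>0 * s j" for j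
      by (simp add: v_eq beta_eq s_def real_sqrt_mult_self add.commute)
    have eq: "(\<Sum>k<n. v (nat K1 + k) / \<beta> (nat K1 + k)) = v0 / \<beta>0 * (\<Sum>k<n. s (a' + k))"
      unfolding a' add_Suc vb by (rule sum_distrib_left[symmetric])
    have "(\<Sum>k<n. s (a' + k)) = sum s ((\<lambda>k. a' + k) ` {..<n})"
      by (subst sum.reindex) (auto simp: inj_on_def)
    also have "\<dots> \<le> sum s {..<a' + n}"
      using s_nonneg by (intro sum_mono2) auto
    also have "\<dots> \<le> 4" unfolding s_def by (rule sum_log_series_le)
    finally have "(\<Sum>k<n. s (a' + k)) \<le> 4" .
    then show ?thesis unfolding eq using v0_pos beta0_pos by (intro mult_left_mono) auto
  qed
  let ?d = "\<lambda>k. lagr (\<beta> (nat K1 + k)) (y (nat K1 + k)) (z (nat K1 + k)) (x (nat K1 + k))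
      - lagr (\<beta> (nat K1 + k)) (y (nat K1 + k)) (z (nat K1 + k)) (x (Suc (nat K1 + k)))"
  have \<beta>_0: "\<beta> 0 = \<beta>0" by (simp add: beta_eq)
  have Fmax_nonneg: "0 \<le> Fmax" using F_le[OF init(1)] by linarith
  \<comment> \<open>The coefficient 7/2 is 14/4, and the series bound 4 turns
    \<open>3 / 2 * Cp + Bp\<close> into \<open>6 * Cp + 4 * Bp\<close>.\<close>
  have Cx_ge: "2 * Fmax + (7 / 2 * Cp\<^sup>2) / \<beta>0 + (3 / 2 * Cp + Bp) * (v0 / \<beta>0 * 4) \<le> Cx"
  proof -
    have "(7 / 2 * Cp\<^sup>2) / \<beta>0 \<le> 1 / (4 * \<beta>0) * (14 * Cp\<^sup>2 + 8 * Bp * Cp + 7 * Bp\<^sup>2)"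
      using beta0_pos Bp_nonneg Cp_pos by (simp add: field_simps)
    moreover have "(3 / 2 * Cp + Bp) * (v0 / \<beta>0 * 4) = (6 * Cp + 4 * Bp) * (v0 / \<beta>0)"
      by (simp add: algebra_simps)
    moreover have "(6 * Cp + 4 * Bp) * (v0 / \<beta>0) \<le> (10 * Cp + 4 * Bp) * (v0 / \<beta>0)"
      using v0_pos beta0_pos Cp_pos by (intro mult_right_mono) auto
    moreover have "0 \<le> \<beta>0 / 2 * ((norm (A *v x 0 - b))\<^sup>2 + (norm (pos_part (g (x 0) + z 0 /\<^sub>R \<beta>0)))\<^sup>2)"
      using beta0_pos by simp
    ultimately show ?thesis unfolding Cx_eq Fmax_def[symmetric] by linarith
  qed
  have sum_le: "(\<Sum>k<n. ?d k) \<le> Cx" for n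
  proof -
    have "1 \<le> nat K1" using K1_pos by simp
    from sum_lagr_diff_le_constant[OF F_le Cp4 this v_sum, of n]
    show ?thesis using Cx_ge by (simp add: \<beta>_0)
  qed
  have Cx_pos: "0 < Cx"
  proof -
    have "0 < (7 / 2 * Cp\<^sup>2) / \<beta>0" "0 \<le> (3 / 2 * Cp + Bp) * (v0 / \<beta>0 * 4)"
      using Cp_pos Bp_nonneg v0_pos beta0_pos by auto
    then show ?thesis using Cx_ge Fmax_nonneg by linarith
  qed
  have K2_ge: "16 * Cx * \<rho> / \<epsilon>\<^sup>2 \<le> real_of_int K2"
    by (simp only: K2_eq le_of_int_ceiling)
  have "0 < 16 * Cx * \<rho> / \<epsilon>\<^sup>2" using Cx_pos rho_pos eps_pos by simp
  then have K2_pos: "1 \<le> K2" using K2_ge by linarith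
  show ?thesis
  proof (rule ccontr)
    assume contra: "\<not> ?thesis"
    \<comment> \<open>Strictness requires at least one summand, hence \<open>K2 \<ge> 1\<close>; the
      left side is at least \<open>Cx\<close> by the choice of \<open>K2\<close>.\<close>
    have "(\<Sum>k<nat K2. \<epsilon>\<^sup>2 / (16 * \<rho>)) < (\<Sum>k<nat K2. ?d k)"
    proof (rule sum_strict_mono)
      fix k assume "k \<in> {..<nat K2}"
      then have "int (nat K1 + k) < K1 + K2" using K1_pos by auto
      then have "\<not> near_eps_kkt_point \<rho> F A b g \<epsilon> (x (Suc (nat K1 + k)))" using contra by blast
      then have "\<epsilon> < 2 * \<rho> * norm (u (nat K1 + k) - x (nat K1 + k))"
        using near[of "nat K1 + k"] by force
      then show "\<epsilon>\<^sup>2 / (16 * \<rho>) < ?d k" by (rule decrease)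
    qed (use K2_pos in \<open>auto simp: lessThan_empty_iff\<close>)
    then have "real_of_int K2 * (\<epsilon>\<^sup>2 / (16 * \<rho>)) < Cx"
      using sum_le[of "nat K2"] K2_pos by simp
    moreover have "Cx \<le> real_of_int K2 * (\<epsilon>\<^sup>2 / (16 * \<rho>))"
      using K2_ge rho_pos eps_pos by (simp add: field_simps)
    ultimately show False by linarith
  qed
qed

end
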